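(* There is a randomized algorithm which, given $\delta\in(0,1/2)$ and a set $X$ of $n$ points in $\mathbb{R}^d$ (accessible only through noisy coordinate-comparison queries), outputs a subset of $X$ which, with probability at least $1-\delta$, is the skyline of $X$, and whose expected number of queries is $O(ndk\log(k/\delta)+dk^2\log(kn/\delta))$, where $k=|\mathrm{skyline}(X)|$. The algorithm does not need to know $k$.
   Context: Noisy comparison model: the algorithm may ask queries of the form "is the $i$-th coordinate of point $p$ (strictly) smaller than that of point $q$?"; each answer is correct with probability at least $2/3$, independently of all other answers. A point $p$ is dominated by $q$ if $p_i\le q_i$ for every coordinate $i$, and strictly dominated if moreover $p_i<q_i$ for at least one $i$. The skyline of $X$ is the set of points of $X$ not strictly dominated by any other point of $X$. *)

theory Defs
  imports "HOL-Probability.Probability"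
begin

text \<open>
  A point of \<open>\<real>\<^sup>d\<close> is an extensional function on the coordinates \<open>{..<d}\<close>, so that the
  dimension can be an input of an algorithm.
\<close>

type_synonym point = "nat \<Rightarrow> real"

definition euclid :: "nat \<Rightarrow> point set" where
  "euclid d = {..<d} \<rightarrow>\<^sub>E UNIV"

definition dominated :: "nat \<Rightarrow> point \<Rightarrow> point \<Rightarrow> bool" where
  "dominated d p q \<longleftrightarrow> (\<forall>i<d. p i \<le> q i)"

definition strictly_dominated :: "nat \<Rightarrow> point \<Rightarrow> point \<Rightarrow> bool" where
  "strictly_dominated d p q \<longleftrightarrow> dominated d p q \<and> (\<exists>i<d. p i < q i)"

definition skyline :: "nat \<Rightarrow> point set \<Rightarrow> point set" where
  "skyline d X = {p \<in> X. \<forall>q \<in> X. q \<noteq> p \<longrightarrow> \<not> strictly_dominated d p q}"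

text \<open>
  A randomized query algorithm is a possibly infinite decision tree. The points of the input are
  known to it only by labels: \<open>Query i a b\<close> asks whether coordinate \<open>i\<close> of the point labelled
  \<open>a\<close> is strictly smaller than coordinate \<open>i\<close> of the point labelled \<open>b\<close> and continues
  according to the answer, while \<open>Sample\<close> draws internal randomness and is not a query.
\<close>

codatatype 'r query_alg =
    Return 'r
  | Query nat nat nat "bool \<Rightarrow> 'r query_alg"
  | Sample "nat pmf" "nat \<Rightarrow> 'r query_alg"

text \<open>
  The correct answers on the input \<open>pt 0, \<dots>, pt (n - 1)\<close> in dimension \<open>d\<close>. Queries about
  labels or coordinates that do not exist have the constant answer \<open>False\<close>, so they reveal
  nothing.
\<close>

definition truth :: "nat \<Rightarrow> nat \<Rightarrow> (nat \<Rightarrow> point) \<Rightarrow> nat \<Rightarrow> nat \<Rightarrow> nat \<Rightarrow> bool" where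
  "truth n d pt i a b \<longleftrightarrow> i < d \<and> a < n \<and> b < n \<and> pt a i < pt b i"

text \<open>
  \<open>acc t i a b\<close> is the probability that the answer to \<open>Query i a b\<close> is correct when it is
  asked after \<open>t\<close> earlier queries; a fresh coin is tossed for every query. Repeating a query
  thus yields a new, independent answer.
\<close>

definition noise_model :: "(nat \<Rightarrow> nat \<Rightarrow> nat \<Rightarrow> nat \<Rightarrow> real) \<Rightarrow> bool" where
  "noise_model acc \<longleftrightarrow> (\<forall>t i a b. 2/3 \<le> acc t i a b \<and> acc t i a b \<le> 1)"

text \<open>
  Joint distribution of the output and the total number of queries, for a run that starts after
  \<open>t\<close> queries. The missing mass is the probability that the run does not terminate.
\<close>

partial_function (spmf) run ::
    "(nat \<Rightarrow> nat \<Rightarrow> nat \<Rightarrow> bool) \<Rightarrow> (nat \<Rightarrow> nat \<Rightarrow> nat \<Rightarrow> nat \<Rightarrow> real)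
      \<Rightarrow> nat \<Rightarrow> 'r query_alg \<Rightarrow> ('r \<times> nat) spmf" where
  "run tr acc t A = (case A of
      Return r \<Rightarrow> return_spmf (r, t)
    | Query i a b f \<Rightarrow> bind_spmf (spmf_of_pmf (bernoulli_pmf (acc t i a b)))
        (\<lambda>correct. run tr acc (Suc t) (f (if correct then tr i a b else \<not> tr i a b)))
    | Sample P f \<Rightarrow> bind_spmf (spmf_of_pmf P) (\<lambda>x. run tr acc t (f x)))"

end

theory Submission
  imports Defs
begin

text \<open>
  The skyline points found so far form a list \<open>S\<close> of length \<open>s\<close>, and every point \<open>x\<close> is tested
  once for being dominated by a member of \<open>S\<close>. If it is not, the lexicographically largest point
  dominating \<open>x\<close> is a new skyline point, which a tournament of cost \<open>O(n d log (s/\<delta>))\<close> finds.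

  Wrongly dismissing a point only matters for the \<open>k\<close> skyline points, so each such error may have
  probability about \<open>\<delta>/s\<^sup>2\<close>; wrongly retaining a dominated point must be as unlikely as \<open>\<delta>/n\<close>.
  The test therefore repeats itself with doubled precision as long as it finds \<open>x\<close> not
  dominated: a dominated point pays \<open>O(d s log (s/\<delta>))\<close> in expectation, and only the roughly \<open>k\<close>
  points that are not dominated pay for the full precision, \<open>O(d s log (s n/\<delta>))\<close>. Tournaments over
  the coordinates decide dominance without a factor \<open>log d\<close>. As \<open>s\<close> may exceed \<open>k\<close> after an
  error, the expected cost is bounded by a potential function of the state.
\<close>

section \<open>Query algorithms under the worst accuracies\<close>

text \<open>The accuracy of an answer may vary with the query and its time, so error probabilities
  have no closed form. Every estimate goes through \<open>upper\<close>, a supremum computed along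
  the decision tree; it is subadditive and composes with \<open>bind_prog\<close>, which replaces
  arguments by independence and by conditioning. The expected cost includes runs that have already
  failed, in which S may grow to n labels, while \<delta> may be a constant. Splitting the cost into
  success and failure is therefore too coarse; the potential bounds the cost from every list S,
  right or wrong. The lexicographic order serves two ends: it is total on distinct points, so a
  tournament has a unique winner, and it extends dominance, so the largest point dominating x is not
  strictly dominated itself.\<close>

text \<open>
  Algorithms of bounded depth without internal randomness suffice.
\<close>

datatype 'r prog = Ret 'r | Ask nat nat nat "'r prog" "'r prog"

primrec alg_of :: "'r prog \<Rightarrow> 'r query_alg" where
  "alg_of (Ret r) = Return r"
| "alg_of (Ask i a b p q) = Query i a b (\<lambda>z. if z then alg_of p else alg_of q)"

primrec bind_prog :: "'a prog \<Rightarrow> ('a \<Rightarrow> 'b prog) \<Rightarrow> 'b prog" where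
  "bind_prog (Ret r) g = g r"
| "bind_prog (Ask i a b p q) g = Ask i a b (bind_prog p g) (bind_prog q g)"

primrec depth :: "'r prog \<Rightarrow> nat" where
  "depth (Ret r) = 0"
| "depth (Ask i a b p q) = Suc (max (depth p) (depth q))"

text \<open>
  The supremum, over all accuracies permitted by the noise model, of the expectation of \<open>\<phi>\<close> at
  the result plus \<open>c\<close> per query. The worst accuracy is always \<open>1\<close> or \<open>2/3\<close>.
\<close>

primrec upper :: "(nat \<Rightarrow> nat \<Rightarrow> nat \<Rightarrow> bool) \<Rightarrow> real \<Rightarrow> ('r \<Rightarrow> real) \<Rightarrow> 'r prog \<Rightarrow> real" where
  "upper tr c \<phi> (Ret r) = \<phi> r"
| "upper tr c \<phi> (Ask i a b p q) =
    (let u = upper tr c \<phi> p; v = upper tr c \<phi> q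
     in c + (if tr i a b then max u (2/3 * u + 1/3 * v) else max v (2/3 * v + 1/3 * u)))"

section \<open>Worst-case expectation as a sublinear functional\<close>

lemma depth_bind_le:
  assumes "\<And>r. depth (g r) \<le> K"
  shows "depth (bind_prog A g) \<le> depth A + K"
  using assms by (induction A) (auto simp: max_def)

lemma set_bind_prog: "set_prog (bind_prog A g) = (\<Union>r\<in>set_prog A. set_prog (g r))"
  by (induction A) auto

lemma upper_bind: "upper tr c \<phi> (bind_prog A g) = upper tr c (\<lambda>r. upper tr c \<phi> (g r)) A"
  by (induction A) (auto simp: Let_def)

lemma upper_mono:
  assumes "\<And>r. \<phi> r \<le> \<psi> r"
  shows "upper tr c \<phi> A \<le> upper tr c \<psi> A"
proof (induction A)
  case (Ask i a b p q)
  have aux: "max u (2/3 * u + 1/3 * v) \<le> max u' (2/3 * u' + 1/3 * v')"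
    if "u \<le> u'" "v \<le> v'" for u u' v v' :: real
    using that by (auto simp: max_def)
  show ?case using aux Ask by (auto simp: Let_def)
qed (use assms in auto)

text \<open>Nonnegative factors pass through the maxima in \<open>upper\<close>; negative ones would
  turn them into minima. The price per query is zero because it would not be scaled.\<close>

lemma upper_affine:
  assumes "\<alpha> \<ge> 0"
  shows "upper tr 0 (\<lambda>r. \<beta> + \<alpha> * \<phi> r) A = \<beta> + \<alpha> * upper tr 0 \<phi> A"
proof (induction A)
  case (Ask i a b p q)
  have aux: "max (\<beta> + \<alpha> * u) (2/3 * (\<beta> + \<alpha> * u) + 1/3 * (\<beta> + \<alpha> * v))
      = \<beta> + \<alpha> * max u (2/3 * u + 1/3 * v)" for u v
  proof -
    have "max (\<beta> + \<alpha> * u) (2/3 * (\<beta> + \<alpha> * u) + 1/3 * (\<beta> + \<alpha> * v))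
        = \<beta> + max (\<alpha> * u) (\<alpha> * (2/3 * u + 1/3 * v))"
      by (simp add: max_def field_simps)
    then show ?thesis using assms by (simp add: max_mult_distrib_left)
  qed
  show ?case by (simp only: upper.simps Let_def Ask aux if_distrib add_0 split: if_split) simp
qed simp

lemma upper_const [simp]: "upper tr 0 (\<lambda>r. \<beta>) A = \<beta>"
  using upper_affine[of 0 tr \<beta> "\<lambda>_. 0" A] by simp

text \<open>The two suprema on the right may be attained at different accuracies. Splitting the
  price as 1 + 0 separates the queries of a program from the value of its result.\<close>

lemma upper_add_le:
  "upper tr (c + c') (\<lambda>r. \<phi> r + \<psi> r) A \<le> upper tr c \<phi> A + upper tr c' \<psi> A"
proof (induction A)
  case (Ask i a b p q)
  have aux: "max u (2/3 * u + 1/3 * v) \<le> max u1 (2/3 * u1 + 1/3 * v1) + max u2 (2/3 * u2 + 1/3 * v2)"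
    if "u \<le> u1 + u2" "v \<le> v1 + v2" for u u1 u2 v v1 v2 :: real
  proof (rule max.boundedI)
    show "u \<le> max u1 (2/3 * u1 + 1/3 * v1) + max u2 (2/3 * u2 + 1/3 * v2)"
      using that(1) by linarith
    show "2/3 * u + 1/3 * v \<le> max u1 (2/3 * u1 + 1/3 * v1) + max u2 (2/3 * u2 + 1/3 * v2)"
      using that max.cobounded2[of "2/3 * u1 + 1/3 * v1" u1] max.cobounded2[of "2/3 * u2 + 1/3 * v2" u2]
      by linarith
  qed
  show ?case using Ask by (auto simp: Let_def intro!: aux)
qed simp

lemma upper_le_depth: "upper tr 1 (\<lambda>_. 0) A \<le> real (depth A)"
proof (induction A)
  case (Ask i a b p q)
  have aux: "max u (2/3 * u + 1/3 * v) \<le> max u' v'"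
    if "u \<le> u'" "v \<le> v'" for u u' v v' :: real
    using that by (auto simp: max_def)
  show ?case using aux[OF Ask] aux[OF Ask(2,1)] by (auto simp: Let_def max.commute)
qed simp

lemma upper_cost_le: "upper tr 1 \<phi> A \<le> upper tr 1 (\<lambda>_. 0) A + upper tr 0 \<phi> A"
  using upper_add_le[of tr 1 0 "\<lambda>_. 0" \<phi> A] by simp

lemma upper_cost_le_depth: "upper tr 1 \<phi> A \<le> real (depth A) + upper tr 0 \<phi> A"
  using upper_cost_le[of tr \<phi> A] upper_le_depth[of tr A] by linarith

abbreviation err :: "(nat \<Rightarrow> nat \<Rightarrow> nat \<Rightarrow> bool) \<Rightarrow> ('r \<Rightarrow> bool) \<Rightarrow> 'r prog \<Rightarrow> real" where
  "err tr P A \<equiv> upper tr 0 (\<lambda>r. of_bool (\<not> P r)) A"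

lemma err_le_1: "err tr P A \<le> 1"
  using upper_mono[of "\<lambda>r. of_bool (\<not> P r)" "\<lambda>_. 1::real" tr 0 A] by simp

text \<open>This replaces conditioning on \<open>P\<close>: \<phi> lies below an affine function of
  the indicator of failure, with values g and b, and \<open>g \<le> b\<close> makes its slope
  nonnegative.\<close>

lemma upper_le_good_bad:
  assumes "\<And>r. P r \<Longrightarrow> \<phi> r \<le> g" "\<And>r. \<phi> r \<le> b" "g \<le> b" "err tr P A \<le> \<epsilon>"
  shows "upper tr 0 \<phi> A \<le> g + \<epsilon> * (b - g)"
proof -
  have "upper tr 0 \<phi> A \<le> upper tr 0 (\<lambda>r. g + (b - g) * of_bool (\<not> P r)) A"
    by (intro upper_mono) (use assms(1,2) in auto)
  also have "\<dots> = g + (b - g) * err tr P A"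
    using assms(3) by (intro upper_affine) simp
  also have "\<dots> \<le> g + (b - g) * \<epsilon>"
    using assms(3,4) by (intro add_left_mono mult_left_mono) auto
  finally show ?thesis by (simp add: mult.commute)
qed

text \<open>A union bound without independence: a failure of \<open>P\<close> is charged 1, anything
  else \<epsilon>'. With \<open>P = (\<lambda>_. True)\<close> and \<epsilon> = 0 it skips a first
  program whose result does not matter.\<close>

lemma err_bind_le:
  assumes "err tr P A \<le> \<epsilon>" "\<And>r. P r \<Longrightarrow> err tr Q (g r) \<le> \<epsilon>'" "0 \<le> \<epsilon>'"
  shows "err tr Q (bind_prog A g) \<le> \<epsilon> + \<epsilon>'"
proof -
  have "err tr Q (bind_prog A g) \<le> upper tr 0 (\<lambda>r. \<epsilon>' + 1 * of_bool (\<not> P r)) A"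
    unfolding upper_bind by (intro upper_mono) (use assms(2,3) err_le_1[of tr Q] in \<open>auto intro: add_increasing\<close>)
  also have "\<dots> = \<epsilon>' + err tr P A"
    by (subst upper_affine) auto
  finally show ?thesis using assms(1) by linarith
qed

section \<open>Transfer to runs under an arbitrary noise model\<close>

lemma run_Return: "run tr acc t (Return r) = return_spmf (r, t)"
  by (subst run.simps) simp

lemma run_Query:
  "run tr acc t (Query i a b f) = bind_spmf (spmf_of_pmf (bernoulli_pmf (acc t i a b)))
     (\<lambda>correct. run tr acc (Suc t) (f (if correct then tr i a b else \<not> tr i a b)))"
  by (subst run.simps) simp

lemma lossless_run_alg_of: "lossless_spmf (run tr acc t (alg_of A))"
  by (induction A arbitrary: t) (auto simp: run_Return run_Query)

lemma set_run_alg_of: "(r, c) \<in> set_spmf (run tr acc t (alg_of A)) \<Longrightarrow> r \<in> set_prog A"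
proof (induction A arbitrary: t)
  case (Ask i a b p q)
  from Ask.prems have "(r, c) \<in> set_spmf (run tr acc (Suc t) (alg_of p))
      \<or> (r, c) \<in> set_spmf (run tr acc (Suc t) (alg_of q))"
    unfolding alg_of.simps run_Query set_bind_spmf by (auto simp: Set.bind_def split: if_splits)
  then show ?case using Ask.IH by auto
qed (auto simp: run_Return)

lemma nn_integral_bind_bernoulli:
  assumes "0 \<le> x" "x \<le> 1"
  shows "(\<integral>\<^sup>+ y. f y \<partial>measure_spmf (bind_spmf (spmf_of_pmf (bernoulli_pmf x)) D))
    = ennreal x * (\<integral>\<^sup>+ y. f y \<partial>measure_spmf (D True))
      + ennreal (1 - x) * (\<integral>\<^sup>+ y. f y \<partial>measure_spmf (D False))"
  unfolding measure_spmf_bind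
  by (subst nn_integral_bind[where B = "count_space UNIV"])
    (use assms in \<open>auto simp: space_subprob_algebra subprob_space_measure_spmf measure_spmf_spmf_of_pmf mult.commute\<close>)

lemma upper_nonneg:
  assumes "\<And>r. 0 \<le> \<phi> r" "0 \<le> c"
  shows "0 \<le> upper tr c \<phi> A"
proof (induction A)
  case (Ask i a b p q)
  then show ?case using assms(2) by (auto simp: Let_def intro!: add_nonneg_nonneg simp: le_max_iff_disj)
qed (use assms in auto)

text \<open>With an indicator \<phi> and c = 0 this bounds a failure probability, with \<phi> = 0
  and c = 1 the expected number of queries. The summand \<open>c * real t\<close> pays for the
  earlier queries, which \<open>run\<close> includes in its count.\<close>

lemma upper_sound:
  assumes acc: "noise_model acc" and nonneg: "\<And>r. 0 \<le> \<phi> r" "0 \<le> c"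
  shows "(\<integral>\<^sup>+ (r, q). ennreal (\<phi> r + c * real q) \<partial>measure_spmf (run tr acc t (alg_of A)))
    \<le> ennreal (upper tr c \<phi> A + c * real t)"
proof (induction A arbitrary: t)
  case (Ret r)
  then show ?case by (simp add: run_Return measure_spmf_return_spmf nn_integral_return)
next
  case (Ask i a b p q)
  define x where "x = acc t i a b"
  define u where "u = upper tr c \<phi> (if tr i a b then p else q)"
  define v where "v = upper tr c \<phi> (if tr i a b then q else p)"
  have x: "2/3 \<le> x" "x \<le> 1"
    using acc by (auto simp: noise_model_def x_def)
  have uv: "0 \<le> u" "0 \<le> v"
    by (auto simp: u_def v_def intro!: upper_nonneg nonneg)
  define I where "I = (\<lambda>B. \<integral>\<^sup>+ (r, q). ennreal (\<phi> r + c * real q)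
      \<partial>measure_spmf (run tr acc (Suc t) (alg_of B)))"
  define y where "y = c * real (Suc t)"
  have y: "0 \<le> y" using nonneg by (simp add: y_def)
  have I: "I (if tr i a b then p else q) \<le> ennreal (u + y)" "I (if tr i a b then q else p) \<le> ennreal (v + y)"
    using Ask[of "Suc t"] unfolding I_def u_def v_def y_def by auto
  have "(\<integral>\<^sup>+ (r, q). ennreal (\<phi> r + c * real q) \<partial>measure_spmf (run tr acc t (alg_of (Ask i a b p q))))
      = ennreal x * I (if tr i a b then p else q) + ennreal (1 - x) * I (if tr i a b then q else p)"
    unfolding alg_of.simps run_Query I_def x_def[symmetric]
    by (subst nn_integral_bind_bernoulli) (use x in auto)
  also have "\<dots> \<le> ennreal x * ennreal (u + y) + ennreal (1 - x) * ennreal (v + y)"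
    by (intro add_mono mult_left_mono I) auto
  also have "\<dots> = ennreal (x * (u + y) + (1 - x) * (v + y))"
    using x uv y by (simp add: ennreal_mult ennreal_plus)
  \<comment> \<open>Affine in x, hence largest on [2/3, 1] at 2/3 if u \<le> v and at 1
    otherwise.\<close>
  also have "x * (u + y) + (1 - x) * (v + y) \<le> max u (2/3 * u + 1/3 * v) + y"
  proof (cases "u \<le> v")
    case True
    have "(x - 2/3) * (v - u) \<ge> 0" using x True by (intro mult_nonneg_nonneg) auto
    moreover have "x * (u + y) + (1 - x) * (v + y) = (2/3 * u + 1/3 * v) + y - (x - 2/3) * (v - u)"
      by (simp add: field_simps)
    ultimately show ?thesis by linarith
  next
    case False
    have "(1 - x) * (u - v) \<ge> 0" using x False by (intro mult_nonneg_nonneg) auto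
    then have "x * (u + y) + (1 - x) * (v + y) \<le> u + y"
      by (simp add: algebra_simps)
    then show ?thesis by linarith
  qed
  also have "max u (2/3 * u + 1/3 * v) + y = upper tr c \<phi> (Ask i a b p q) + c * real t"
    by (simp add: u_def v_def y_def Let_def algebra_simps)
  finally show ?case by (simp add: ennreal_leI)
qed

section \<open>Amplification and tournaments\<close>

text \<open>z is the lead of positive over negative answers. At a tie the potential used for the
  error is 1, so either verdict on a tie would satisfy the bound.\<close>

primrec majority :: "nat \<Rightarrow> int \<Rightarrow> nat \<Rightarrow> nat \<Rightarrow> nat \<Rightarrow> bool prog" where
  "majority 0 z i a b = Ret (z > 0)"
| "majority (Suc m) z i a b = Ask i a b (majority m (z + 1) i a b) (majority m (z - 1) i a b)"

lemma depth_majority: "depth (majority m z i a b) = m"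
  by (induction m arbitrary: z) auto

text \<open>
  The potential \<open>\<theta> powi (wrong answers - right answers)\<close> with \<open>\<theta> = sqrt 2\<close> shrinks in
  expectation by the factor \<open>2/3 / \<theta> + 1/3 * \<theta> = 2 * sqrt 2 / 3\<close> with every query.
\<close>

lemma err_majority:
  "err tr (\<lambda>r. r = tr i a b) (majority m z i a b)
    \<le> (2 * sqrt 2 / 3) ^ m * sqrt 2 powi (if tr i a b then - z else z)"
proof (induction m arbitrary: z)
  case 0
  have "1 \<le> sqrt 2 powi z" if "z \<ge> 0" for z
    using that by (intro one_le_power_int) auto
  then show ?case by auto
next
  case (Suc m)
  define w where "w = (if tr i a b then - z else z)"
  define X where "X = (2 * sqrt 2 / 3) ^ m * sqrt 2 powi w"
  define u where "u = err tr (\<lambda>r. r = tr i a b) (majority m (if tr i a b then z + 1 else z - 1) i a b)"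
  define v where "v = err tr (\<lambda>r. r = tr i a b) (majority m (if tr i a b then z - 1 else z + 1) i a b)"
  have X: "X \<ge> 0" by (simp add: X_def)
  have w1: "sqrt 2 powi (w - 1) = sqrt 2 powi w * (sqrt 2 / 2)"
    by (simp add: power_int_diff field_simps)
  have w2: "sqrt 2 powi (w + 1) = sqrt 2 powi w * sqrt 2"
    by (simp add: power_int_add)
  have "u \<le> (2 * sqrt 2 / 3) ^ m * sqrt 2 powi (w - 1)"
    using Suc[of "if tr i a b then z + 1 else z - 1"]
    by (cases "tr i a b") (simp_all only: u_def w_def if_True if_False minus_add_distrib diff_conv_add_uminus)
  then have u: "u \<le> X * (sqrt 2 / 2)"
    unfolding w1 X_def by (simp add: mult_ac)
  have "v \<le> (2 * sqrt 2 / 3) ^ m * sqrt 2 powi (w + 1)"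
    using Suc[of "if tr i a b then z - 1 else z + 1"]
    by (cases "tr i a b") (simp_all only: v_def w_def if_True if_False minus_add_distrib diff_conv_add_uminus minus_minus)
  then have v: "v \<le> X * sqrt 2"
    unfolding w2 X_def by (simp add: mult_ac)
  \<comment> \<open>The supremum also covers a certainly correct answer, which shrinks the potential
    by 1 / sqrt 2.\<close>
  have "X * (sqrt 2 / 2) \<le> X * (2 * sqrt 2 / 3)"
    using X by (intro mult_left_mono) auto
  then have "max u (2/3 * u + 1/3 * v) \<le> X * (2 * sqrt 2 / 3)"
    using u v by (auto simp: max_def)
  then show ?case
    by (auto simp: Let_def u_def v_def X_def w_def mult_ac split: if_splits)
qed

text \<open>Twelve answers are the fewest for which the factor (2 * sqrt 2 / 3)^12 = (8/9)^6 is at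
  most 1/2.\<close>

definition coord_test :: "nat \<Rightarrow> nat \<Rightarrow> nat \<Rightarrow> nat \<Rightarrow> bool prog" where
  "coord_test m i a b = majority (12 * m) 0 i a b"

lemma depth_coord_test: "depth (coord_test m i a b) = 12 * m"
  by (simp add: coord_test_def depth_majority)

lemma err_coord_test: "err tr (\<lambda>r. r = tr i a b) (coord_test m i a b) \<le> (1/2) ^ m"
proof -
  have "(2 * sqrt 2 / 3) ^ 12 = ((2 * sqrt 2 / 3)\<^sup>2) ^ 6"
    by (simp add: power_mult[symmetric])
  also have "(2 * sqrt 2 / 3)\<^sup>2 = (8/9 :: real)"
    by (simp add: power_divide power_mult_distrib)
  finally have "(2 * sqrt 2 / 3) ^ 12 \<le> (1/2 :: real)"
    by (simp add: power_divide)
  then have "((2 * sqrt 2 / 3) ^ 12) ^ m \<le> (1/2 :: real) ^ m"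
    by (intro power_mono) auto
  then show ?thesis
    using order_trans[OF err_majority[of tr i a b "12 * m" 0]] by (simp add: coord_test_def power_mult)
qed

text \<open>
  The error allowed in a match halves with its height, so that the errors along the path of the
  winner sum up to that of a leaf, while the total cost stays linear in the number of leaves.
\<close>

primrec tournament :: "(nat \<Rightarrow> nat \<Rightarrow> nat \<Rightarrow> nat prog) \<Rightarrow> nat \<Rightarrow> nat \<Rightarrow> nat \<Rightarrow> nat prog" where
  "tournament mt m 0 lo = Ret lo"
| "tournament mt m (Suc h) lo =
    bind_prog (tournament mt m h lo) (\<lambda>u.
    bind_prog (tournament mt m h (lo + 2 ^ h)) (\<lambda>v. mt (m + Suc h) u v))"

text \<open>The recurrence D (h + 1) = 2 * D h + \<kappa> * (m + h + 2) with D 0 = 0 has the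
  solution \<kappa> * ((m + 3) * 2^h - (m + h + 3)). Without the subtracted term the induction would
  not close.\<close>

lemma depth_tournament_aux:
  assumes "\<And>m u v. real (depth (mt m u v)) \<le> \<kappa> * (real m + 1)"
  shows "real (depth (tournament mt m h lo)) + \<kappa> * (real m + real h + 3) \<le> \<kappa> * (real m + 3) * 2 ^ h"
proof (induction h arbitrary: lo)
  case (Suc h)
  let ?D = "\<lambda>lo. depth (tournament mt m h lo)"
  \<comment> \<open>\<open>depth_bind_le\<close> takes a natural number, uniform in the first
    result, hence the rounding.\<close>
  define K where "K = nat \<lfloor>\<kappa> * (real (m + Suc h) + 1)\<rfloor>"
  have "0 \<le> \<kappa> * (real (m + Suc h) + 1)"
    using assms[of "m + Suc h" 0 0] by linarith
  then have K: "real K \<le> \<kappa> * (real (m + Suc h) + 1)"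
    by (simp add: K_def)
  have "depth (mt (m + Suc h) u v) \<le> K" for u v
    using assms[of "m + Suc h" u v] unfolding K_def by linarith
  then have "depth (tournament mt m (Suc h) lo) \<le> ?D lo + (?D (lo + 2 ^ h) + K)"
    unfolding tournament.simps by (intro depth_bind_le)
  then have "real (depth (tournament mt m (Suc h) lo)) \<le> real (?D lo) + real (?D (lo + 2 ^ h)) + \<kappa> * (real (m + Suc h) + 1)"
    using K by linarith
  moreover have "\<kappa> * (real m + 3) * 2 ^ Suc h = 2 * (\<kappa> * (real m + 3) * 2 ^ h)"
    by simp
  moreover have "\<kappa> * (real m + real (Suc h) + 3) + \<kappa> * (real (m + Suc h) + 1) = 2 * (\<kappa> * (real m + real h + 3))"
    by (simp add: algebra_simps)
  ultimately show ?case
    using Suc[of lo] Suc[of "lo + 2 ^ h"] by linarith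
qed simp

lemma depth_tournament:
  assumes "\<And>m u v. real (depth (mt m u v)) \<le> \<kappa> * (real m + 1)" "0 \<le> \<kappa>"
  shows "real (depth (tournament mt m h lo)) \<le> \<kappa> * (real m + 3) * 2 ^ h"
proof -
  have "0 \<le> \<kappa> * (real m + real h + 3)" using assms(2) by simp
  then show ?thesis using depth_tournament_aux[of mt \<kappa> m h lo, OF assms(1)] by linarith
qed

text \<open>Only the matches of w count: w beats any opponent, so it is irrelevant whom the other
  half delivers. Their errors (1/2)^(m+1), ..., (1/2)^(m+h) add up to the bound proved by
  induction.\<close>

lemma err_tournament:
  assumes "\<And>m u. err tr (\<lambda>r. r = w) (mt m u w) \<le> (1/2) ^ m"
    and "\<And>m u. err tr (\<lambda>r. r = w) (mt m w u) \<le> (1/2) ^ m"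
    and "lo \<le> w" "w < lo + 2 ^ h"
  shows "err tr (\<lambda>r. r = w) (tournament mt m h lo) \<le> (1/2) ^ m"
proof -
  have "err tr (\<lambda>r. r = w) (tournament mt m h lo) \<le> (1/2) ^ m * (1 - (1/2) ^ h)"
    using assms(3,4)
  proof (induction h arbitrary: lo)
    case (Suc h)
    have split: "(1/2) ^ m * (1 - (1/2) ^ Suc h) = (1/2) ^ m * (1 - (1/2) ^ h) + (1/2::real) ^ (m + Suc h)"
      by (simp add: power_add algebra_simps)
    show ?case
    proof (cases "w < lo + 2 ^ h")
      case True
      have "err tr (\<lambda>r. r = w) (bind_prog (tournament mt m h (lo + 2 ^ h)) (\<lambda>v. mt (m + Suc h) w v))
          \<le> 0 + (1/2) ^ (m + Suc h)"
        by (rule err_bind_le[where P = "\<lambda>_. True"]) (rule assms(2) | simp)+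
      then show ?thesis
        unfolding tournament.simps split
        by (intro err_bind_le[where P = "\<lambda>r. r = w"]) (use Suc.IH[of lo] Suc.prems True in auto)
    next
      case False
      have *: "err tr (\<lambda>r. r = w) (bind_prog (tournament mt m h (lo + 2 ^ h)) (\<lambda>v. mt (m + Suc h) u v))
          \<le> (1/2) ^ m * (1 - (1/2) ^ h) + (1/2) ^ (m + Suc h)" for u
      proof (rule err_bind_le[where P = "\<lambda>r. r = w"])
        show "err tr (\<lambda>r. r = w) (mt (m + Suc h) u v) \<le> (1/2) ^ (m + Suc h)" if "v = w" for v
          unfolding that by (rule assms(1))
      qed (use Suc.IH[of "lo + 2 ^ h"] Suc.prems False in auto)
      have "err tr (\<lambda>r. r = w) (tournament mt m (Suc h) lo)
          \<le> 0 + ((1/2) ^ m * (1 - (1/2) ^ h) + (1/2) ^ (m + Suc h))"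
        unfolding tournament.simps
        by (rule err_bind_le[where P = "\<lambda>_. True"]) (rule * | simp add: power_le_one)+
      then show ?thesis unfolding split by simp
    qed
  qed simp
  also have "\<dots> \<le> (1/2) ^ m"
    by (simp add: mult_left_le)
  finally show ?thesis .
qed

definition height :: "nat \<Rightarrow> nat" where
  "height n = (LEAST h. n \<le> 2 ^ h)"

lemma le_height: "n \<le> 2 ^ height n"
  unfolding height_def by (rule LeastI[of _ n]) (simp add: less_imp_le)

lemma height_le:
  assumes "n > 0"
  shows "2 ^ height n \<le> 2 * n"
proof (cases "height n")
  case (Suc h)
  then have "\<not> n \<le> 2 ^ h"
    using not_less_Least[of h "\<lambda>h. n \<le> 2 ^ h"] by (simp add: height_def)
  then show ?thesis by (simp add: Suc)
qed (use assms in simp)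

text \<open>The result is arbitrary if no index below \<open>d\<close> satisfies the tested predicate.\<close>

definition first_index :: "(nat \<Rightarrow> nat \<Rightarrow> bool prog) \<Rightarrow> nat \<Rightarrow> nat \<Rightarrow> nat prog" where
  "first_index bt d m =
    tournament (\<lambda>m i j. bind_prog (bt m (min i j)) (\<lambda>r. Ret (if r then min i j else max i j))) m (height d) 0"

lemma depth_first_index:
  assumes "\<And>m i. real (depth (bt m i)) \<le> \<kappa> * (real m + 1)" "0 \<le> \<kappa>" "0 < d"
  shows "real (depth (first_index bt d m)) \<le> 2 * \<kappa> * d * (real m + 3)"
proof -
  have "depth (bind_prog (bt m (min i j)) (\<lambda>r. Ret (if r then min i j else max i j)))
      \<le> depth (bt m (min i j)) + 0" for m i j
    by (rule depth_bind_le) simp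
  then have "real (depth (bind_prog (bt m (min i j)) (\<lambda>r. Ret (if r then min i j else max i j))))
      \<le> \<kappa> * (real m + 1)" for m i j
    by (rule order_trans[OF of_nat_mono]) (use assms(1) in simp)
  then have "real (depth (first_index bt d m)) \<le> \<kappa> * (real m + 3) * 2 ^ height d"
    unfolding first_index_def by (rule depth_tournament) (use assms in auto)
  also have "\<dots> \<le> \<kappa> * (real m + 3) * (2 * real d)"
    using of_nat_mono[OF height_le[OF assms(3)], where 'a = real] assms(2)
    by (intro mult_left_mono) simp_all
  finally show ?thesis by (simp add: mult_ac)
qed

text \<open>A match tests the smaller index only. Against a larger opponent w itself is tested and
  holds, against a smaller one the opponent is tested and fails; either way w wins. Padding indices
  exceed w and are never tested against it.\<close>

lemma err_first_index:
  assumes bt: "\<And>m i. err tr (\<lambda>r. r = \<beta> i) (bt m i) \<le> (1/2) ^ m"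
    and w: "\<beta> w" "\<And>i. i < w \<Longrightarrow> \<not> \<beta> i" "w < d"
  shows "err tr (\<lambda>r. r = w) (first_index bt d m) \<le> (1/2) ^ m"
  unfolding first_index_def
proof (rule err_tournament)
  fix m u
  have *: "err tr (\<lambda>r. r = w) (bind_prog (bt m (min u w)) (\<lambda>r. Ret (if r then min u w else max u w)))
      \<le> (1/2) ^ m + 0"
    by (rule err_bind_le[OF bt]) (use w in \<open>auto simp: min_def max_def\<close>)
  then show "err tr (\<lambda>r. r = w) (bind_prog (bt m (min u w)) (\<lambda>r. Ret (if r then min u w else max u w)))
      \<le> (1/2) ^ m"
    and "err tr (\<lambda>r. r = w) (bind_prog (bt m (min w u)) (\<lambda>r. Ret (if r then min w u else max w u)))
      \<le> (1/2) ^ m"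
    unfolding min.commute[of w u] max.commute[of w u] by simp_all
qed (use w le_height[of d] in auto)

section \<open>Tests on points\<close>

text \<open>The search returns some coordinate even if none refutes dominance, so a last test
  decides. If x is dominated, the correct answer is no at every coordinate, and errors of the search
  are harmless.\<close>

definition dominated_test :: "nat \<Rightarrow> nat \<Rightarrow> nat \<Rightarrow> nat \<Rightarrow> bool prog" where
  "dominated_test d m x q =
    bind_prog (first_index (\<lambda>m i. coord_test m i q x) d m) (\<lambda>i.
    bind_prog (coord_test m i q x) (\<lambda>r. Ret (\<not> r)))"

text \<open>With \<open>Suc m\<close> the errors of the two comparisons add up to the (1/2)^m that
  \<open>first_index\<close> expects.\<close>

definition lex_test :: "nat \<Rightarrow> nat \<Rightarrow> nat \<Rightarrow> nat \<Rightarrow> bool prog" where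
  "lex_test d m y z =
    bind_prog (first_index (\<lambda>m i. bind_prog (coord_test (Suc m) i y z) (\<lambda>r.
      bind_prog (coord_test (Suc m) i z y) (\<lambda>r'. Ret (r \<or> r')))) d m)
    (\<lambda>i. coord_test m i y z)"

text \<open>
  The winner between \<open>y\<close> and \<open>z\<close> is the lexicographically larger one among those that dominate
  \<open>x\<close>; labels from \<open>n\<close> on only pad the tournament.
\<close>

definition play_match :: "nat \<Rightarrow> nat \<Rightarrow> nat \<Rightarrow> nat \<Rightarrow> nat \<Rightarrow> nat \<Rightarrow> nat prog" where
  "play_match d n x m y z = (if y \<ge> n then Ret z else if z \<ge> n then Ret y else
    bind_prog (dominated_test d (m + 3) x z) (\<lambda>bz. if \<not> bz then Ret y else
    bind_prog (dominated_test d (m + 3) x y) (\<lambda>by. if \<not> by then Ret z else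
    bind_prog (lex_test d (m + 3) y z) (\<lambda>l. Ret (if l then z else y)))))"

definition find_skyline :: "nat \<Rightarrow> nat \<Rightarrow> nat \<Rightarrow> nat \<Rightarrow> nat prog" where
  "find_skyline d n m x = tournament (play_match d n x) m (height n) 0"

primrec covered_test :: "nat \<Rightarrow> nat \<Rightarrow> nat \<Rightarrow> nat list \<Rightarrow> bool prog" where
  "covered_test d m x [] = Ret False"
| "covered_test d m x (q # S) =
    bind_prog (dominated_test d m x q) (\<lambda>r. if r then Ret True else covered_test d m x S)"

text \<open>
  Since the precision doubles, a covered point is usually dismissed after the first, cheap round,
  and the last round dominates the cost for the few points that are not covered.
\<close>

primrec uncovered_test :: "nat \<Rightarrow> nat \<Rightarrow> nat \<Rightarrow> nat \<Rightarrow> nat list \<Rightarrow> bool prog" where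
  "uncovered_test d 0 m x S = Ret True"
| "uncovered_test d (Suc l) m x S =
    bind_prog (covered_test d m x S) (\<lambda>r. if r then Ret False else uncovered_test d l (2 * m) x S)"

section \<open>Query counts of the tests in the worst case\<close>

lemma depth_dominated_test:
  assumes "d > 0"
  shows "real (depth (dominated_test d m x q)) \<le> 36 * real d * (real m + 3)"
proof -
  have "depth (dominated_test d m x q) \<le> depth (first_index (\<lambda>m i. coord_test m i q x) d m) + (12 * m + 0)"
    unfolding dominated_test_def depth_coord_test[symmetric, of m undefined undefined undefined]
    by (intro depth_bind_le order_trans[OF depth_bind_le[where K = 0]]) (auto simp: depth_coord_test)
  then have "real (depth (dominated_test d m x q))
      \<le> real (depth (first_index (\<lambda>m i. coord_test m i q x) d m)) + 12 * real m"
    by linarith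
  also have "real (depth (first_index (\<lambda>m i. coord_test m i q x) d m)) \<le> 2 * 12 * real d * (real m + 3)"
    by (rule depth_first_index) (use assms in \<open>auto simp: depth_coord_test\<close>)
  also have "12 * real m \<le> 12 * real d * (real m + 3)"
    using assms by (intro mult_mono) auto
  finally show ?thesis by (simp add: algebra_simps)
qed

lemma depth_lex_test:
  assumes "d > 0"
  shows "real (depth (lex_test d m y z)) \<le> 108 * real d * (real m + 3)"
proof -
  let ?bt = "\<lambda>m i. bind_prog (coord_test (Suc m) i y z) (\<lambda>r.
      bind_prog (coord_test (Suc m) i z y) (\<lambda>r'. Ret (r \<or> r')))"
  have "depth (?bt m i) \<le> 12 * Suc m + (12 * Suc m + 0)" for m i
    by (metis (no_types, lifting) depth_bind_le depth_coord_test order_refl depth.simps(1))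
  then have bt: "real (depth (?bt m i)) \<le> 24 * (real m + 1)" for m i
    by (rule order_trans[OF of_nat_mono]) simp
  have "depth (lex_test d m y z) \<le> depth (first_index ?bt d m) + 12 * m"
    unfolding lex_test_def by (intro depth_bind_le) (simp add: depth_coord_test)
  then have "real (depth (lex_test d m y z)) \<le> real (depth (first_index ?bt d m)) + 12 * real m"
    by linarith
  also have "real (depth (first_index ?bt d m)) \<le> 2 * 24 * real d * (real m + 3)"
    by (rule depth_first_index[OF bt]) (use assms in auto)
  also have "12 * real m \<le> 60 * real d * (real m + 3)"
    using assms by (intro mult_mono) auto
  finally show ?thesis by (simp add: algebra_simps)
qed

lemma depth_play_match:
  assumes "d > 0"
  shows "real (depth (play_match d n x m y z)) \<le> 1080 * real d * (real m + 1)"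
proof -
  define A where "A = nat \<lfloor>36 * real d * (real (m + 3) + 3)\<rfloor>"
  define B where "B = nat \<lfloor>108 * real d * (real (m + 3) + 3)\<rfloor>"
  have A: "depth (dominated_test d (m + 3) x q) \<le> A" for q
    using depth_dominated_test[OF assms, of "m + 3" x q] unfolding A_def by linarith
  have B: "depth (lex_test d (m + 3) y z) \<le> B"
    using depth_lex_test[OF assms, of "m + 3" y z] unfolding B_def by linarith
  have 1: "depth (bind_prog (lex_test d (m + 3) y z) (\<lambda>l. Ret (if l then z else y))) \<le> B + 0"
    by (rule order_trans[OF depth_bind_le add_right_mono[OF B]]) simp
  have 2: "depth (bind_prog (dominated_test d (m + 3) x y) (\<lambda>by. if \<not> by then Ret z else
    bind_prog (lex_test d (m + 3) y z) (\<lambda>l. Ret (if l then z else y)))) \<le> A + B"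
    by (rule order_trans[OF depth_bind_le add_right_mono[OF A]]) (use 1 in auto)
  have "depth (play_match d n x m y z) \<le> A + (A + B)"
    unfolding play_match_def
    by (auto intro!: order_trans[OF depth_bind_le[where K = "A + B"] add_right_mono[OF A]]) (use 2 in auto)
  then have "real (depth (play_match d n x m y z)) \<le> 2 * real A + real B"
    by linarith
  moreover have "0 \<le> 36 * real d * (real (m + 3) + 3)" "0 \<le> 108 * real d * (real (m + 3) + 3)"
    by auto
  then have "real A \<le> 36 * real d * (real (m + 3) + 3)" "real B \<le> 108 * real d * (real (m + 3) + 3)"
    unfolding A_def B_def by linarith+
  ultimately have "real (depth (play_match d n x m y z)) \<le> 180 * real d * (real m + 6)"
    by (simp add: algebra_simps)
  also have "\<dots> \<le> 180 * real d * (6 * (real m + 1))"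
    by (intro mult_left_mono) auto
  finally show ?thesis by (simp add: algebra_simps)
qed

lemma depth_find_skyline:
  assumes "d > 0" "n > 0"
  shows "real (depth (find_skyline d n m x)) \<le> 2160 * real n * real d * (real m + 3)"
proof -
  have "real (depth (find_skyline d n m x)) \<le> 1080 * real d * (real m + 3) * 2 ^ height n"
    unfolding find_skyline_def by (rule depth_tournament) (use depth_play_match[OF assms(1)] in auto)
  also have "\<dots> \<le> 1080 * real d * (real m + 3) * (2 * real n)"
    using of_nat_mono[OF height_le[OF assms(2)], where 'a = real]
    by (intro mult_left_mono) simp_all
  finally show ?thesis by (simp add: mult_ac)
qed

lemma depth_covered_test:
  assumes "d > 0"
  shows "real (depth (covered_test d m x S)) \<le> 36 * real d * (real m + 3) * length S"
proof (induction S)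
  case (Cons q S)
  have "depth (covered_test d m x (q # S)) \<le> depth (dominated_test d m x q) + depth (covered_test d m x S)"
    unfolding covered_test.simps by (rule depth_bind_le) auto
  then have "real (depth (covered_test d m x (q # S)))
      \<le> real (depth (dominated_test d m x q)) + real (depth (covered_test d m x S))"
    by linarith
  also have "\<dots> \<le> 36 * real d * (real m + 3) + 36 * real d * (real m + 3) * length S"
    by (intro add_mono Cons depth_dominated_test assms)
  finally show ?case by (simp add: algebra_simps)
qed simp

lemma depth_uncovered_test:
  assumes "d > 0"
  shows "real (depth (uncovered_test d l m x S)) \<le> 36 * real d * (real m + 3) * length S * (2 ^ l - 1)"
proof (induction l arbitrary: m)
  case (Suc l)
  have "depth (uncovered_test d (Suc l) m x S)
      \<le> depth (covered_test d m x S) + depth (uncovered_test d l (2 * m) x S)"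
    unfolding uncovered_test.simps by (rule depth_bind_le) auto
  then have "real (depth (uncovered_test d (Suc l) m x S))
      \<le> real (depth (covered_test d m x S)) + real (depth (uncovered_test d l (2 * m) x S))"
    by linarith
  also have "\<dots> \<le> 36 * real d * (real m + 3) * length S + 36 * real d * (real (2 * m) + 3) * length S * (2 ^ l - 1)"
    by (intro add_mono Suc depth_covered_test assms)
  also have "36 * real d * (real (2 * m) + 3) * length S * (2 ^ l - 1)
      \<le> 36 * real d * (2 * (real m + 3)) * length S * (2 ^ l - 1)"
    by (intro mult_right_mono mult_left_mono) auto
  finally show ?case by (simp add: algebra_simps)
qed simp

section \<open>Correctness of the tests\<close>

locale skyline_input =
  fixes d n :: nat and X :: "point set" and pt :: "nat \<Rightarrow> point"
  assumes X_subset: "X \<subseteq> euclid d" and bij_pt: "bij_betw pt {..<n} X"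
begin

abbreviation tr :: "nat \<Rightarrow> nat \<Rightarrow> nat \<Rightarrow> bool" where
  "tr \<equiv> truth n d pt"

text \<open>Every label is below a junk label \<open>q \<ge> n\<close>, since queries about \<open>q\<close> have the answer \<open>False\<close>.\<close>

definition label_le :: "nat \<Rightarrow> nat \<Rightarrow> bool" where
  "label_le x q \<longleftrightarrow> (\<forall>i. \<not> tr i q x)"

definition lex_less :: "nat \<Rightarrow> nat \<Rightarrow> bool" where
  "lex_less y z \<longleftrightarrow> (\<exists>w. tr w y z \<and> (\<forall>i<w. \<not> tr i y z \<and> \<not> tr i z y))"

definition covered :: "nat \<Rightarrow> nat list \<Rightarrow> bool" where
  "covered x S \<longleftrightarrow> (\<exists>q\<in>set S. label_le x q)"

definition skyline_labels :: "nat set" where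
  "skyline_labels = {x. x < n \<and> pt x \<in> skyline d X}"

section \<open>Dominance and the lexicographic order on labels\<close>

lemma tr_less: "tr i a b \<Longrightarrow> i < d"
  by (simp add: truth_def)

lemma label_le_iff: "x < n \<Longrightarrow> q < n \<Longrightarrow> label_le x q \<longleftrightarrow> dominated d (pt x) (pt q)"
  by (auto simp: label_le_def truth_def dominated_def not_less dest: leD)

lemma label_le_refl: "x < n \<Longrightarrow> label_le x x"
  by (simp add: label_le_def truth_def)

lemma ex_tr:
  assumes "y < n" "z < n" "y \<noteq> z"
  shows "\<exists>i. tr i y z \<or> tr i z y"
proof -
  have "pt y \<noteq> pt z"
    using assms bij_pt by (auto simp: bij_betw_def inj_on_def)
  moreover have "pt y \<in> {..<d} \<rightarrow>\<^sub>E UNIV" "pt z \<in> {..<d} \<rightarrow>\<^sub>E UNIV"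
    using assms bij_pt X_subset by (auto simp: bij_betw_def euclid_def)
  ultimately obtain i where "i < d" "pt y i \<noteq> pt z i"
    using PiE_ext[of "pt y" "{..<d}" "\<lambda>_. UNIV" "pt z"] by blast
  then show ?thesis using assms by (auto simp: truth_def neq_iff)
qed

lemma lex_less_total:
  assumes "y < n" "z < n" "y \<noteq> z"
  shows "lex_less y z \<or> lex_less z y"
proof -
  let ?P = "\<lambda>i. tr i y z \<or> tr i z y"
  have "?P (LEAST i. ?P i)" using ex_tr[OF assms] by (rule LeastI_ex)
  moreover have "\<forall>i<(LEAST i. ?P i). \<not> ?P i" using not_less_Least by blast
  ultimately show ?thesis unfolding lex_less_def by blast
qed

lemma tr_asym: "tr i y z \<Longrightarrow> \<not> tr i z y"
  by (auto simp: truth_def)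

lemma lex_less_asym:
  assumes "lex_less y z"
  shows "\<not> lex_less z y"
proof
  assume "lex_less z y"
  then obtain v where v: "tr v z y" "\<And>i. i < v \<Longrightarrow> \<not> tr i y z"
    by (auto simp: lex_less_def)
  obtain w where w: "tr w y z" "\<And>i. i < w \<Longrightarrow> \<not> tr i z y"
    using assms by (auto simp: lex_less_def)
  show False
    using v w tr_asym by (cases v w rule: linorder_cases) blast+
qed

lemma lex_less_trans:
  assumes "lex_less x y" "lex_less y z"
  shows "lex_less x z"
proof -
  obtain v where v: "tr v x y" "\<And>i. i < v \<Longrightarrow> \<not> tr i x y \<and> \<not> tr i y x"
    using assms(1) by (auto simp: lex_less_def)
  obtain w where w: "tr w y z" "\<And>i. i < w \<Longrightarrow> \<not> tr i y z \<and> \<not> tr i z y"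
    using assms(2) by (auto simp: lex_less_def)
  have lt: "v < d" "w < d" "x < n" "y < n" "z < n"
    using v(1) w(1) by (auto simp: truth_def)
  have eq: "pt x i = pt y i" if "i < v" for i
    using v(2)[OF that] that lt by (auto simp: truth_def)
  have eq': "pt y i = pt z i" if "i < w" for i
    using w(2)[OF that] that lt by (auto simp: truth_def)
  have less: "pt x v < pt y v" "pt y w < pt z w"
    using v(1) w(1) by (auto simp: truth_def)
  have "pt x (min v w) < pt z (min v w)"
    using less eq[of w] eq'[of v] by (cases v w rule: linorder_cases) (simp_all add: min_def)
  then have "tr (min v w) x z"
    using lt by (simp add: truth_def)
  moreover have "\<forall>i<min v w. \<not> tr i x z \<and> \<not> tr i z x"
    using eq eq' by (simp add: truth_def)
  ultimately show ?thesis unfolding lex_less_def by blast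
qed

definition is_top :: "nat \<Rightarrow> nat \<Rightarrow> bool" where
  "is_top x w \<longleftrightarrow> w < n \<and> label_le x w \<and> (\<forall>y<n. label_le x y \<and> y \<noteq> w \<longrightarrow> lex_less y w)"

lemma ex_top:
  assumes "x < n"
  shows "\<exists>w. is_top x w"
proof -
  let ?U = "{y. y < n \<and> label_le x y}"
  have "\<exists>w\<in>?U. \<forall>y\<in>?U. y \<noteq> w \<longrightarrow> \<not> lex_less w y"
  proof (rule Finite_Set.bex_max_element)
    show "asymp_on ?U lex_less"
      using lex_less_asym by (auto intro!: asymp_onI)
    show "transp_on ?U lex_less"
      using lex_less_trans by (auto intro!: transp_onI)
  qed (use label_le_refl assms in auto)
  then show ?thesis using lex_less_total by (auto simp: is_top_def)
qed

lemma label_le_trans: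
  assumes "label_le x y" "label_le y z" "x < n" "y < n" "z < n"
  shows "label_le x z"
  using assms unfolding label_le_iff[OF assms(3,4)] label_le_iff[OF assms(4,5)] label_le_iff[OF assms(3,5)]
    dominated_def by (meson order_trans)

text \<open>A point strictly dominating w also dominates x, so it would be lexicographically smaller
  than w, that is, smaller in some coordinate.\<close>

lemma top_in_skyline:
  assumes "x < n" "is_top x w"
  shows "w \<in> skyline_labels"
proof -
  have w: "w < n" "label_le x w" using assms by (auto simp: is_top_def)
  have "\<not> strictly_dominated d (pt w) q" if "q \<in> X" "q \<noteq> pt w" for q
  proof
    assume sd: "strictly_dominated d (pt w) q"
    obtain z where z: "z < n" "q = pt z"
      using bij_pt \<open>q \<in> X\<close> by (auto simp: bij_betw_def)
    have "label_le w z"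
      using sd z w by (simp add: label_le_iff strictly_dominated_def)
    moreover from this have "label_le x z"
      using label_le_trans assms(1) w z by blast
    then have "lex_less z w"
      using assms(2) z that(2) by (auto simp: is_top_def)
    ultimately show False by (auto simp: lex_less_def label_le_def)
  qed
  moreover have "pt w \<in> X" using w bij_pt by (auto simp: bij_betw_def)
  ultimately show ?thesis using w by (auto simp: skyline_labels_def skyline_def)
qed

text \<open>Hence a skyline point covered by genuine skyline labels has already been found, and the
  tournament started from an uncovered skyline point aims at that point itself.\<close>

lemma skyline_label_le_eq:
  assumes "x \<in> skyline_labels" "q < n" "label_le x q"
  shows "q = x"
proof (rule ccontr)
  assume "q \<noteq> x"
  have x: "x < n" "pt x \<in> skyline d X" using assms(1) by (auto simp: skyline_labels_def)
  have "\<exists>i. tr i x q"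
    using ex_tr[OF x(1) assms(2)] \<open>q \<noteq> x\<close> assms(3) by (auto simp: label_le_def)
  then have "strictly_dominated d (pt x) (pt q)"
    using label_le_iff[OF x(1) assms(2)] assms(3) by (auto simp: strictly_dominated_def truth_def)
  moreover have "pt q \<noteq> pt x" "pt q \<in> X"
    using \<open>q \<noteq> x\<close> x(1) assms(2) bij_pt by (auto simp: bij_betw_def inj_on_def)
  ultimately show False using x(2) by (auto simp: skyline_def)
qed

lemma image_skyline_labels: "pt ` skyline_labels = skyline d X"
  using bij_pt by (auto simp: skyline_labels_def bij_betw_def skyline_def)

lemma finite_skyline_labels: "finite skyline_labels"
  by (rule finite_subset[of _ "{..<n}"]) (auto simp: skyline_labels_def)

lemma card_skyline_labels: "card skyline_labels = card (skyline d X)"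
proof -
  have "inj_on pt skyline_labels"
    using bij_pt by (auto simp: bij_betw_def skyline_labels_def intro: inj_on_subset)
  then show ?thesis using card_image image_skyline_labels by metis
qed

section \<open>Error probabilities and expected costs of the tests\<close>

lemma err_dominated_test:
  "err tr (\<lambda>r. r = label_le x q) (dominated_test d m x q) \<le> 2 * (1/2) ^ m"
proof -
  have *: "err tr (\<lambda>r. r = label_le x q) (bind_prog (coord_test m i q x) (\<lambda>r. Ret (\<not> r)))
      \<le> (1/2) ^ m + 0" if "tr i q x \<longleftrightarrow> \<not> label_le x q" for i
    by (rule err_bind_le[OF err_coord_test]) (use that in auto)
  show ?thesis
  proof (cases "label_le x q")
    case True
    have "err tr (\<lambda>r. r = label_le x q) (dominated_test d m x q) \<le> 0 + ((1/2) ^ m + 0)"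
      unfolding dominated_test_def
      by (rule err_bind_le[where P = "\<lambda>_. True"], simp, rule *)
        (use True in \<open>auto simp: label_le_def\<close>)
    then show ?thesis by (rule order_trans) simp
  next
    case False
    define w where "w = (LEAST i. tr i q x)"
    have w: "tr w q x"
      using False unfolding w_def label_le_def by (metis LeastI)
    have "err tr (\<lambda>r. r = label_le x q) (dominated_test d m x q) \<le> (1/2) ^ m + ((1/2) ^ m + 0)"
      unfolding dominated_test_def
    proof (rule err_bind_le[where P = "\<lambda>i. i = w"])
      show "err tr (\<lambda>i. i = w) (first_index (\<lambda>m i. coord_test m i q x) d m) \<le> (1/2) ^ m"
        by (rule err_first_index[where \<beta> = "\<lambda>i. tr i q x"])
          (use err_coord_test w tr_less not_less_Least w_def in blast)+
    qed (use * w False in auto)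
    then show ?thesis by simp
  qed
qed

lemma err_lex_test:
  assumes "y < n" "z < n" "y \<noteq> z"
  shows "err tr (\<lambda>r. r = lex_less y z) (lex_test d m y z) \<le> 2 * (1/2) ^ m"
proof -
  let ?P = "\<lambda>i. tr i y z \<or> tr i z y"
  define w where "w = (LEAST i. ?P i)"
  have w: "?P w" using ex_tr[OF assms] unfolding w_def by (rule LeastI_ex)
  have less: "\<not> ?P i" if "i < w" for i using that not_less_Least w_def by blast
  have lex: "tr w y z = lex_less y z"
    using w less lex_less_asym[of y z] unfolding lex_less_def by metis
  have "err tr (\<lambda>r. r = lex_less y z) (lex_test d m y z) \<le> (1/2) ^ m + (1/2) ^ m"
    unfolding lex_test_def
  proof (rule err_bind_le[where P = "\<lambda>i. i = w"])
    have bt: "err tr (\<lambda>r. r = ?P i) (bind_prog (coord_test (Suc m) i y z) (\<lambda>r.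
      bind_prog (coord_test (Suc m) i z y) (\<lambda>r'. Ret (r \<or> r')))) \<le> (1/2) ^ m" for m i
    proof -
      have "err tr (\<lambda>r. r = ?P i) (bind_prog (coord_test (Suc m) i y z) (\<lambda>r.
        bind_prog (coord_test (Suc m) i z y) (\<lambda>r'. Ret (r \<or> r')))) \<le> (1/2) ^ Suc m + ((1/2) ^ Suc m + 0)"
        by (rule err_bind_le[OF err_coord_test], rule err_bind_le[OF err_coord_test]) auto
      then show ?thesis by simp
    qed
    show "err tr (\<lambda>i. i = w) (first_index (\<lambda>m i. bind_prog (coord_test (Suc m) i y z) (\<lambda>r.
      bind_prog (coord_test (Suc m) i z y) (\<lambda>r'. Ret (r \<or> r')))) d m) \<le> (1/2) ^ m"
      by (rule err_first_index[where \<beta> = ?P]) (use bt w less tr_less in blast)+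
    show "err tr (\<lambda>r. r = lex_less y z) (coord_test m i y z) \<le> (1/2) ^ m" if "i = w" for i
      unfolding that lex[symmetric] by (rule err_coord_test)
  qed simp
  then show ?thesis by simp
qed

lemma err_play_match:
  assumes w: "is_top x w"
  shows "err tr (\<lambda>r. r = w) (play_match d n x m u w) \<le> (1/2) ^ m"
    and "err tr (\<lambda>r. r = w) (play_match d n x m w u) \<le> (1/2) ^ m"
proof -
  have wn: "w < n" and le: "label_le x w" using w by (auto simp: is_top_def)
  let ?e = "2 * (1/2) ^ (m + 3) :: real"
  \<comment> \<open>Three tests at precision m + 3 err with 3 * 2/8 = 3/4 of the allowed
    (1/2)^m.\<close>
  have e: "?e + (?e + (?e + 0)) \<le> (1/2) ^ m"
    by (simp add: power_add power3_eq_cube)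
  have e0: "0 \<le> ?e" by simp
  show "err tr (\<lambda>r. r = w) (play_match d n x m u w) \<le> (1/2) ^ m"
  proof (cases "u < n \<and> u \<noteq> w")
    case True
    have lex: "label_le x u \<Longrightarrow> lex_less u w"
      using w True by (auto simp: is_top_def)
    have 1: "err tr (\<lambda>r. r = w) (bind_prog (lex_test d (m + 3) u w) (\<lambda>l. Ret (if l then w else u)))
        \<le> ?e + 0" if "label_le x u"
      by (rule err_bind_le[OF err_lex_test]) (use lex that True wn in auto)
    have 2: "err tr (\<lambda>r. r = w) (bind_prog (dominated_test d (m + 3) x u) (\<lambda>by. if \<not> by then Ret w else
        bind_prog (lex_test d (m + 3) u w) (\<lambda>l. Ret (if l then w else u)))) \<le> ?e + (?e + 0)"
      by (rule err_bind_le[OF err_dominated_test]) (use 1 in auto)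
    have "err tr (\<lambda>r. r = w) (play_match d n x m u w) \<le> ?e + (?e + (?e + 0))"
      unfolding play_match_def using True wn
      by (simp only: not_le[symmetric] simp_thms if_False)
        (rule err_bind_le[OF err_dominated_test], use 2 le in auto)
    then show ?thesis using e by linarith
  next
    case False
    then consider "u \<ge> n" | "u = w" by linarith
    then show ?thesis
    proof cases
      case 1
      then show ?thesis by (simp add: play_match_def)
    next
      case 2
      have "err tr (\<lambda>r. r = w) (play_match d n x m w w) \<le> 0"
        unfolding play_match_def by (simp add: upper_bind if_distrib cong: if_cong)
      then show ?thesis unfolding 2 by (rule order_trans) simp
    qed
  qed
  show "err tr (\<lambda>r. r = w) (play_match d n x m w u) \<le> (1/2) ^ m"
  proof (cases "u < n \<and> u \<noteq> w")
    case True
    have lex: "label_le x u \<Longrightarrow> \<not> lex_less w u"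
      using w True lex_less_asym by (auto simp: is_top_def)
    have 1: "err tr (\<lambda>r. r = w) (bind_prog (lex_test d (m + 3) w u) (\<lambda>l. Ret (if l then u else w)))
        \<le> ?e + 0" if "label_le x u"
      by (rule err_bind_le[OF err_lex_test]) (use lex that True wn in auto)
    have 2: "err tr (\<lambda>r. r = w) (bind_prog (dominated_test d (m + 3) x w) (\<lambda>by. if \<not> by then Ret u else
        bind_prog (lex_test d (m + 3) w u) (\<lambda>l. Ret (if l then u else w)))) \<le> ?e + (?e + 0)" if "label_le x u"
      by (rule err_bind_le[OF err_dominated_test]) (use 1[OF that] le in auto)
    have "err tr (\<lambda>r. r = w) (play_match d n x m w u) \<le> ?e + (?e + (?e + 0))"
      unfolding play_match_def using True wn
      by (simp only: not_le[symmetric] simp_thms if_False)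
        (rule err_bind_le[OF err_dominated_test], use 2 in auto)
    then show ?thesis using e by linarith
  next
    case False
    then consider "u \<ge> n" | "u = w" by linarith
    then show ?thesis
    proof cases
      case 1
      then show ?thesis using wn by (simp add: play_match_def)
    next
      case 2
      have "err tr (\<lambda>r. r = w) (play_match d n x m w w) \<le> 0"
        unfolding play_match_def by (simp add: upper_bind if_distrib cong: if_cong)
      then show ?thesis unfolding 2 by (rule order_trans) simp
    qed
  qed
qed

lemma err_find_skyline:
  assumes "is_top x w"
  shows "err tr (\<lambda>r. r = w) (find_skyline d n m x) \<le> (1/2) ^ m"
  unfolding find_skyline_def
  by (rule err_tournament) (use err_play_match[OF assms] assms le_height[of n] in \<open>auto simp: is_top_def\<close>)

text \<open>A premature \<open>True\<close> is right by luck, so only the test against one covering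
  q counts and no factor \<open>length S\<close> arises.\<close>

lemma err_covered_test_yes:
  assumes "covered x S"
  shows "err tr (\<lambda>r. r) (covered_test d m x S) \<le> 2 * (1/2) ^ m"
  using assms
proof (induction S)
  case (Cons q S)
  show ?case
  proof (cases "label_le x q")
    case True
    have "err tr (\<lambda>r. r) (covered_test d m x (q # S)) \<le> 2 * (1/2) ^ m + 0"
      unfolding covered_test.simps by (rule err_bind_le[OF err_dominated_test]) (use True in auto)
    then show ?thesis by simp
  next
    case False
    then have "covered x S" using Cons.prems by (simp add: covered_def)
    have "err tr (\<lambda>r. r) (covered_test d m x (q # S)) \<le> 0 + 2 * (1/2) ^ m"
      unfolding covered_test.simps
      by (rule err_bind_le[where P = "\<lambda>_. True"]) (use Cons.IH[OF \<open>covered x S\<close>] in auto)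
    then show ?thesis by simp
  qed
qed (simp add: covered_def)

lemma err_covered_test_no:
  assumes "\<not> covered x S"
  shows "err tr (\<lambda>r. \<not> r) (covered_test d m x S) \<le> 2 * real (length S) * (1/2) ^ m"
  using assms
proof (induction S)
  case (Cons q S)
  have "\<not> covered x S" "\<not> label_le x q" using Cons.prems by (auto simp: covered_def)
  then have "err tr (\<lambda>r. \<not> r) (covered_test d m x (q # S)) \<le> 2 * (1/2) ^ m + 2 * real (length S) * (1/2) ^ m"
    unfolding covered_test.simps
    by (intro err_bind_le[OF err_dominated_test]) (use Cons.IH in auto)
  then show ?case by (simp add: algebra_simps)
qed simp

text \<open>Retaining a covered point requires an error in every round; the last and most precise
  one alone gives the bound.\<close>

lemma err_uncovered_test_no:
  assumes "covered x S"
  shows "err tr (\<lambda>r. \<not> r) (uncovered_test d (Suc l) m x S) \<le> 2 * (1/2) ^ (m * 2 ^ l)"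
proof (induction l arbitrary: m)
  case 0
  have "err tr (\<lambda>r. \<not> r) (uncovered_test d (Suc 0) m x S) \<le> 2 * (1/2) ^ m + 0"
    unfolding uncovered_test.simps by (rule err_bind_le[OF err_covered_test_yes[OF assms]]) auto
  then show ?case by simp
next
  case (Suc l)
  have "err tr (\<lambda>r. \<not> r) (uncovered_test d (Suc (Suc l)) m x S) \<le> 0 + 2 * (1/2) ^ (2 * m * 2 ^ l)"
    unfolding uncovered_test.simps(2)[of d "Suc l"]
    by (rule err_bind_le[where P = "\<lambda>_. True"]) (use Suc.IH[of "2 * m"] in auto)
  then show ?case by (simp add: mult_ac)
qed

text \<open>Here the errors of the rounds add up, but doubling the precision makes the sum at most
  twice the first term.\<close>

lemma err_uncovered_test_yes:
  assumes "\<not> covered x S" "m \<ge> 1"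
  shows "err tr (\<lambda>r. r) (uncovered_test d l m x S) \<le> 4 * real (length S) * (1/2) ^ m"
  using assms(2)
proof (induction l arbitrary: m)
  case (Suc l)
  have "err tr (\<lambda>r. r) (uncovered_test d (Suc l) m x S)
      \<le> 2 * real (length S) * (1/2) ^ m + 4 * real (length S) * (1/2) ^ (2 * m)"
    unfolding uncovered_test.simps
    by (intro err_bind_le[OF err_covered_test_no[OF assms(1)]]) (use Suc.IH[of "2 * m"] Suc.prems in auto)
  also have "4 * real (length S) * (1/2) ^ (2 * m) \<le> 4 * real (length S) * (1/2) ^ Suc m"
    using Suc.prems by (intro mult_left_mono power_decreasing) auto
  finally show ?case by simp
qed simp

text \<open>The next round costs about twice as much but is reached with probability at most 1/4, by
  m \<ge> 3, so the series is geometric.\<close>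

lemma cost_uncovered_test:
  assumes "covered x S" "m \<ge> 3" "d > 0"
  shows "upper tr 1 (\<lambda>_. 0) (uncovered_test d l m x S) \<le> 72 * real d * (real m + 3) * length S"
  using assms(2)
proof (induction l arbitrary: m)
  case (Suc l)
  define C where "C = 72 * real d * (real (2 * m) + 3) * length S"
  let ?g = "\<lambda>r. if r then Ret False else uncovered_test d l (2 * m) x S"
  have "upper tr 1 (\<lambda>_. 0) (uncovered_test d (Suc l) m x S)
      = upper tr 1 (\<lambda>r. upper tr 1 (\<lambda>_. 0) (?g r)) (covered_test d m x S)"
    by (simp add: upper_bind)
  also have "\<dots> \<le> depth (covered_test d m x S) + upper tr 0 (\<lambda>r. upper tr 1 (\<lambda>_. 0) (?g r)) (covered_test d m x S)"
    by (rule upper_cost_le_depth)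
  also have "upper tr 0 (\<lambda>r. upper tr 1 (\<lambda>_. 0) (?g r)) (covered_test d m x S) \<le> 0 + 1/4 * (C - 0)"
  proof (rule upper_le_good_bad[where P = "\<lambda>r. r"])
    have "(1/2 :: real) ^ m \<le> (1/2) ^ 3"
      using Suc.prems by (intro power_decreasing) auto
    then show "err tr (\<lambda>r. r) (covered_test d m x S) \<le> 1/4"
      using err_covered_test_yes[OF assms(1), of m] by (simp add: power3_eq_cube)
  qed (use Suc.IH[of "2 * m"] Suc.prems in \<open>auto simp: C_def\<close>)
  also have "real (depth (covered_test d m x S)) \<le> 36 * real d * (real m + 3) * length S"
    by (rule depth_covered_test[OF assms(3)])
  also have "36 * real d * (real m + 3) * length S + (0 + 1/4 * (C - 0))
      = 72 * (real d * length S) * (real m + 9/4)"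
    by (simp add: C_def algebra_simps)
  also have "\<dots> \<le> 72 * (real d * length S) * (real m + 3)"
    by (intro mult_left_mono) auto
  finally show ?case by (simp add: mult_ac)
qed simp

end

section \<open>Error and cost parameters\<close>

text \<open>Of the three factors s + 2, one pays for the union bound over S and two make the errors
  summable over s; 256 is 4 * 64, with 4 from \<open>err_uncovered_test_yes\<close> and 64 from
  \<open>level_error\<close>.\<close>

definition precision :: "real \<Rightarrow> nat \<Rightarrow> nat" where
  "precision \<delta> s = nat \<lceil>log 2 (256 * (real s + 2) ^ 3 / \<delta>)\<rceil>"

text \<open>The last of \<open>Suc j\<close> rounds has precision m * 2^j, which makes its error at
  most 2 * \<delta> / (16 * n).\<close>

definition rounds :: "real \<Rightarrow> nat \<Rightarrow> nat \<Rightarrow> nat" where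
  "rounds \<delta> n m = Suc (LEAST j. log 2 (16 * real n / \<delta>) \<le> real m * 2 ^ j)"

text \<open>Intersecting with \<open>{..<n}\<close> makes every output a set of input labels for any
  S, so the range of tournament results need not be tracked.\<close>

primrec find_all :: "nat \<Rightarrow> nat \<Rightarrow> real \<Rightarrow> nat list \<Rightarrow> nat list \<Rightarrow> nat set prog" where
  "find_all d n \<delta> [] S = Ret (set S \<inter> {..<n})"
| "find_all d n \<delta> (x # xs) S =
    (let m = precision \<delta> (length S) in
      bind_prog (uncovered_test d (rounds \<delta> n m) m x S) (\<lambda>r.
        if r then bind_prog (find_skyline d n m x) (\<lambda>q. find_all d n \<delta> xs (q # S))
        else find_all d n \<delta> xs S))"

lemma set_find_all: "R \<in> set_prog (find_all d n \<delta> xs S) \<Longrightarrow> R \<subseteq> {..<n}"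
  by (induction xs arbitrary: S) (auto simp: Let_def set_bind_prog split: if_splits)

text \<open>The sum over all \<open>s\<close> telescopes to \<open>\<delta> / 64\<close>.\<close>

definition level_error :: "real \<Rightarrow> nat \<Rightarrow> real" where
  "level_error \<delta> s = \<delta> / (64 * (real s + 1) * (real s + 2))"

text \<open>The shift by 2 keeps this at least ln 4, even for w = 0, so it absorbs additive
  constants.\<close>

definition lam :: "real \<Rightarrow> nat \<Rightarrow> real" where
  "lam \<delta> w = ln ((real w + 2) / \<delta>)"

text \<open>Up to a constant, the price per dimension of an uncovered point: a tournament over n
  labels and a full-precision test against at most w points.\<close>

definition unit_cost :: "real \<Rightarrow> nat \<Rightarrow> nat \<Rightarrow> real" where
  "unit_cost \<delta> n w = real n * lam \<delta> w + (real w + 1) * (lam \<delta> w + ln (real n / \<delta>))"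

text \<open>
  Bounds the expected remaining cost, per dimension, with \<open>N\<close> labels left to process and \<open>r\<close>
  skyline points left to find; \<open>w\<close> is \<open>r\<close> plus the number of points already found. Finding a new
  skyline point leaves \<open>w\<close> unchanged and lowers \<open>r\<close>, while an error raises \<open>w\<close> by one.
\<close>

definition potential :: "real \<Rightarrow> nat \<Rightarrow> nat \<Rightarrow> nat \<Rightarrow> nat \<Rightarrow> real" where
  "potential \<delta> n N w r = 30000 * (real N * ((real w + 1) * lam \<delta> w)) + 40000 * (real r * unit_cost \<delta> n w)"

section \<open>Estimates for precisions and numbers of rounds\<close>

lemma log_2_le_ln:
  assumes "1 \<le> x"
  shows "log 2 x \<le> 3/2 * ln x"
proof -
  have "2/3 \<le> ln (2 :: real)"
    using ln2_ge_two_thirds by simp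
  then have "2/3 * ln x \<le> ln 2 * ln x"
    using assms by (intro mult_right_mono) auto
  then show ?thesis by (simp add: log_def field_simps)
qed

context
  fixes \<delta> :: real
  assumes \<delta>: "0 < \<delta>" "\<delta> < 1/2"
begin

lemma lam_mono: "w \<le> w' \<Longrightarrow> lam \<delta> w \<le> lam \<delta> w'"
  using \<delta> by (simp add: lam_def divide_right_mono)

lemma lam_ge_ln4: "ln 4 \<le> lam \<delta> w"
  unfolding lam_def
proof (subst ln_le_cancel_iff)
  have "4 * \<delta> \<le> 2" using \<delta> by simp
  then show "4 \<le> (real w + 2) / \<delta>"
    using \<delta> by (simp add: pos_le_divide_eq)
qed (use \<delta> in auto)

lemma lam_ge: "4/3 \<le> lam \<delta> w"
proof -
  have "ln (4::real) = 2 * ln 2"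
    using ln_realpow[of 2 2] by simp
  then show ?thesis
    using ln2_ge_two_thirds lam_ge_ln4[of w] by linarith
qed

text \<open>The factor w + 2 cancels the increment, so an error raises
  \<open>(real w + 1) * lam \<delta> w\<close> by at most twice
  \<open>lam \<delta> w\<close>.\<close>

lemma lam_Suc: "lam \<delta> (Suc w) \<le> lam \<delta> w + 1 / (real w + 2)"
proof -
  have "(real w + 2) * (1 + 1 / (real w + 2)) = real w + 3"
    by (simp add: field_simps)
  then have "(real w + 3) / \<delta> = ((real w + 2) / \<delta>) * (1 + 1 / (real w + 2))"
    by simp
  moreover have "real (Suc w) + 2 = real w + 3" by simp
  moreover have "0 < (real w + 2) / \<delta>" "0 < 1 + 1 / (real w + 2)"
    using \<delta> by (auto intro: add_pos_nonneg)
  ultimately have "lam \<delta> (Suc w) = lam \<delta> w + ln (1 + 1 / (real w + 2))"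
    unfolding lam_def by (metis ln_mult_pos)
  also have "ln (1 + 1 / (real w + 2)) \<le> 1 / (real w + 2)"
    by (rule ln_add_one_self_le_self) simp
  finally show ?thesis by simp
qed

lemma level_error_pos: "0 < level_error \<delta> s"
  using \<delta> by (simp add: level_error_def)

lemma level_error_le: "level_error \<delta> s \<le> 1/256"
proof -
  have "1 * 2 \<le> (real s + 1) * (real s + 2)"
    by (intro mult_mono) auto
  then have "256 * \<delta> \<le> 64 * ((real s + 1) * (real s + 2))"
    using \<delta> by linarith
  moreover have "0 < 64 * ((real s + 1) * (real s + 2))" by simp
  ultimately have "\<delta> / (64 * ((real s + 1) * (real s + 2))) \<le> 1/256"
    by (subst pos_divide_le_eq) linarith+
  then show ?thesis unfolding level_error_def mult.assoc .
qed

lemma half_power_precision: "(1/2) ^ precision \<delta> s \<le> \<delta> / (256 * (real s + 2) ^ 3)"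
proof -
  let ?x = "256 * (real s + 2) ^ 3 / \<delta>"
  have x: "0 < ?x" using \<delta> by simp
  have "log 2 ?x \<le> real (precision \<delta> s)"
    unfolding precision_def by linarith
  then have "?x \<le> 2 powr real (precision \<delta> s)"
    using x by (subst (asm) log_le_iff) auto
  then have "?x \<le> 2 ^ precision \<delta> s"
    by (simp add: powr_realpow)
  then have "1 / 2 ^ precision \<delta> s \<le> 1 / ?x"
    using x by (intro divide_left_mono mult_pos_pos) auto
  then show ?thesis by (simp add: power_one_over)
qed

lemma half_power_precision_le: "(1/2) ^ precision \<delta> s \<le> level_error \<delta> s"
  and half_power_precision_mult_le: "4 * real s * (1/2) ^ precision \<delta> s \<le> level_error \<delta> s"
proof -
  have pos: "0 < (real s + 2) ^ 3" "0 < 64 * (real s + 1) * (real s + 2)" by auto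
  have "(real s + 1) * (real s + 2) * 1 \<le> (real s + 2) * (real s + 2) * (real s + 2)"
    by (intro mult_mono) auto
  then have "64 * (real s + 1) * (real s + 2) \<le> 256 * (real s + 2) ^ 3"
    using zero_le_mult_iff[of "real s + 1" "real s + 2"] unfolding power3_eq_cube by auto
  then have "\<delta> / (256 * (real s + 2) ^ 3) \<le> level_error \<delta> s"
    unfolding level_error_def using pos \<delta> by (intro divide_left_mono mult_pos_pos) auto
  then show "(1/2) ^ precision \<delta> s \<le> level_error \<delta> s"
    using half_power_precision[of s] by linarith
  have "real s * ((real s + 1) * (real s + 2)) \<le> (real s + 2) * ((real s + 2) * (real s + 2))"
    by (intro mult_mono) auto
  then have "\<delta> * (4 * real s * (64 * (real s + 1) * (real s + 2))) \<le> \<delta> * (256 * (real s + 2) ^ 3)"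
    using \<delta> unfolding power3_eq_cube by (intro mult_left_mono) linarith+
  then have "\<delta> * (4 * real s) / (256 * (real s + 2) ^ 3) \<le> \<delta> / (64 * (real s + 1) * (real s + 2))"
    using pos by (subst frac_le_eq) (auto simp: mult_ac divide_le_0_iff)
  then have "4 * real s * (\<delta> / (256 * (real s + 2) ^ 3)) \<le> level_error \<delta> s"
    unfolding level_error_def by (simp add: mult_ac)
  moreover have "4 * real s * (1/2) ^ precision \<delta> s \<le> 4 * real s * (\<delta> / (256 * (real s + 2) ^ 3))"
    using half_power_precision[of s] by (intro mult_left_mono) auto
  ultimately show "4 * real s * (1/2) ^ precision \<delta> s \<le> level_error \<delta> s"
    by linarith
qed

lemma precision_ge_3: "3 \<le> precision \<delta> s"
proof (rule ccontr)
  assume "\<not> ?thesis"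
  then have "(1/2 :: real) ^ 2 \<le> (1/2) ^ precision \<delta> s"
    by (intro power_decreasing) auto
  then show False
    using half_power_precision_le[of s] level_error_le[of s] by (simp add: power2_eq_square)
qed

lemma precision_le: "real (precision \<delta> s) + 3 \<le> 15 * lam \<delta> s"
proof -
  define y where "y = (real s + 2) / \<delta>"
  have y: "4 \<le> y"
    using \<delta> lam_ge_ln4[of s] by (simp add: lam_def y_def)
  have "256 * (real s + 2) ^ 3 / \<delta> \<le> 256 * y ^ 3"
  proof -
    have "\<delta> ^ 3 \<le> \<delta> ^ 1" using \<delta> by (intro power_decreasing) auto
    then have "(real s + 2) ^ 3 / \<delta> \<le> (real s + 2) ^ 3 / \<delta> ^ 3"
      using \<delta> by (intro divide_left_mono) auto
    then show ?thesis by (simp add: power_divide y_def)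
  qed
  then have "log 2 (256 * (real s + 2) ^ 3 / \<delta>) \<le> log 2 (256 * y ^ 3)"
    using \<delta> y by (subst log_le_cancel_iff) auto
  also have "\<dots> = 8 + 3 * log 2 y"
  proof -
    have "log 2 (256 :: real) = 8"
      using log_pow_cancel[of 2 8] by simp
    then show ?thesis using y by (simp add: log_mult log_nat_power)
  qed
  also have "\<dots> \<le> 8 + 3 * (3/2 * lam \<delta> s)"
    using log_2_le_ln[of y] y by (simp add: lam_def y_def)
  finally have "log 2 (256 * (real s + 2) ^ 3 / \<delta>) \<le> 8 + 9/2 * lam \<delta> s" by simp
  then have "real (precision \<delta> s) \<le> 9 + 9/2 * lam \<delta> s"
    unfolding precision_def using lam_ge[of s] by linarith
  \<comment> \<open>The constant 12 is 9 * 4/3, hence at most 9 times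
    \<open>lam \<delta> s\<close>.\<close>
  then show ?thesis using lam_ge[of s] by linarith
qed

context
  fixes n :: nat
  assumes n: "0 < n"
begin

abbreviation (input) mu :: real where
  "mu \<equiv> ln (real n / \<delta>)"

lemma n_div_\<delta>: "2 \<le> real n / \<delta>"
proof -
  have "1 \<le> real n" using n by simp
  then have "2 * \<delta> \<le> real n" using \<delta> by linarith
  then show ?thesis using \<delta> by (simp add: pos_le_divide_eq)
qed

lemma mu_nonneg: "0 \<le> mu"
  using n_div_\<delta> by simp

text \<open>Crude, but applied only where the failure probability \<delta> / (8 * n) absorbs the
  factor n.\<close>

lemma mu_le: "mu \<le> 2 * real n * lam \<delta> w"
proof -
  have "mu = ln (real n) + ln (1 / \<delta>)"
    using \<delta> n by (simp add: ln_div)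
  also have "ln (real n) \<le> real n * 1"
    using n ln_le_minus_one[of "real n"] by simp
  also have "real n * 1 \<le> real n * lam \<delta> w"
    using lam_ge[of w] by (intro mult_left_mono) auto
  also have "ln (1 / \<delta>) \<le> 1 * lam \<delta> w"
    unfolding lam_def using \<delta> by (simp add: divide_right_mono)
  also have "1 * lam \<delta> w \<le> real n * lam \<delta> w"
    using n lam_ge[of w] by (intro mult_right_mono) auto
  finally show ?thesis by simp
qed

lemma rounds_least:
  obtains j where "rounds \<delta> n m = Suc j"
    "0 < m \<Longrightarrow> log 2 (16 * real n / \<delta>) \<le> real m * 2 ^ j"
    "\<And>i. i < j \<Longrightarrow> real m * 2 ^ i < log 2 (16 * real n / \<delta>)"
proof
  let ?P = "\<lambda>j. log 2 (16 * real n / \<delta>) \<le> real m * 2 ^ j"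
  show "rounds \<delta> n m = Suc (LEAST j. ?P j)" by (simp add: rounds_def)
  show "?P (LEAST j. ?P j)" if m: "0 < m"
  proof (rule LeastI_ex)
    obtain j where j: "log 2 (16 * real n / \<delta>) < 2 ^ j"
      using real_arch_pow[of 2] by auto
    have "1 * 2 ^ j \<le> real m * 2 ^ j"
      using m by (intro mult_right_mono) auto
    then show "\<exists>j. ?P j" using j by (intro exI[of _ j]) linarith
  qed
  show "real m * 2 ^ i < log 2 (16 * real n / \<delta>)" if "i < (LEAST j. ?P j)" for i
    using not_less_Least[OF that] by simp
qed

lemma half_power_rounds:
  assumes "rounds \<delta> n m = Suc j" "0 < m"
  shows "2 * (1/2) ^ (m * 2 ^ j) \<le> \<delta> / (8 * real n)"
proof -
  let ?x = "16 * real n / \<delta>"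
  have x: "0 < ?x" using \<delta> n by simp
  have "log 2 ?x \<le> real (m * 2 ^ j)"
    using rounds_least[of m] assms by (metis of_nat_mult of_nat_numeral of_nat_power old.nat.inject)
  then have "?x \<le> 2 powr real (m * 2 ^ j)"
    using x by (subst (asm) log_le_iff) auto
  then have "?x \<le> 2 ^ (m * 2 ^ j)"
    by (subst (asm) powr_realpow) auto
  then have "1 / 2 ^ (m * 2 ^ j) \<le> 1 / ?x"
    using x by (intro divide_left_mono mult_pos_pos) auto
  then show ?thesis by (simp add: power_one_over)
qed

text \<open>By minimality either one round suffices, or half of the last precision is below the
  target; the two cases give the terms 4 * m and 8 * L.\<close>

lemma rounds_le:
  assumes "m = precision \<delta> s"
  shows "(real m + 3) * 2 ^ rounds \<delta> n m \<le> 75 * (lam \<delta> s + mu)"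
proof -
  obtain j where j: "rounds \<delta> n m = Suc j"
    "\<And>i. i < j \<Longrightarrow> real m * 2 ^ i < log 2 (16 * real n / \<delta>)"
    using rounds_least[of m] by metis
  have m: "3 \<le> m" using assms precision_ge_3 by simp
  define L where "L = log 2 (16 * real n / \<delta>)"
  have L: "L = 4 + log 2 (real n / \<delta>)"
  proof -
    have "log 2 (16 :: real) = 4"
      using log_pow_cancel[of 2 4] by simp
    then show ?thesis
      using log_mult[of 2 16 "real n / \<delta>"] \<delta> n by (simp add: L_def)
  qed
  have "0 \<le> log 2 (real n / \<delta>)" using n_div_\<delta> by simp
  then have L0: "0 \<le> L" using L by linarith
  have "log 2 (real n / \<delta>) \<le> 3/2 * mu"
    using n_div_\<delta> by (intro log_2_le_ln) simp
  then have L1: "L \<le> 4 + 3/2 * mu" using L by linarith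
  have "(real m + 3) * 2 ^ rounds \<delta> n m \<le> (2 * real m) * 2 ^ rounds \<delta> n m"
    using m by (intro mult_right_mono) auto
  also have "\<dots> \<le> 4 * real m + 8 * L"
  proof (cases j)
    case 0
    then show ?thesis using L0 by (simp add: j(1))
  next
    case (Suc i)
    then have "real m * 2 ^ i < L" using j(2)[of i] by (simp add: L_def)
    then show ?thesis by (simp add: j(1) Suc)
  qed
  also have "\<dots> \<le> 75 * (lam \<delta> s + mu)"
    using precision_le[of s, folded assms] lam_ge[of s] L1 mu_nonneg by argo
  finally show ?thesis .
qed

section \<open>Drift of the potential\<close>

lemma unit_cost_mono: "w \<le> w' \<Longrightarrow> unit_cost \<delta> n w \<le> unit_cost \<delta> n w'"
  unfolding unit_cost_def using lam_mono[of w w'] lam_ge[of w] mu_nonneg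
  by (intro add_mono mult_mono) auto

lemma unit_cost_nonneg: "0 \<le> unit_cost \<delta> n w"
  unfolding unit_cost_def using lam_ge[of w] mu_nonneg by auto

lemma potential_mono:
  assumes "w \<le> w'" "r \<le> r'"
  shows "potential \<delta> n N w r \<le> potential \<delta> n N w' r'"
  unfolding potential_def using assms lam_mono[of w w'] lam_ge[of w] unit_cost_mono[of w w'] unit_cost_nonneg[of w]
  by (intro add_mono mult_mono mult_left_mono) auto

text \<open>An error raises each unit cost by about n / (w + 2) plus logarithmic terms, so with r
  \<le> w the total increase is of the order of a single unit cost.\<close>

lemma potential_Suc:
  assumes "N \<le> n" "r \<le> w"
  shows "potential \<delta> n N (Suc w) r \<le> potential \<delta> n N w r
    + (60000 * (real n * lam \<delta> w) + 40000 * (real n + real w * (2 * lam \<delta> w + mu)))"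
proof -
  define l where "l = lam \<delta> w"
  have l: "1 \<le> l" using lam_ge[of w] by (simp add: l_def)
  have l': "lam \<delta> (Suc w) \<le> l + 1 / (real w + 2)"
    using lam_Suc by (simp add: l_def)
  have "(real w + 2) * lam \<delta> (Suc w) \<le> (real w + 2) * (l + 1 / (real w + 2))"
    using l' by (intro mult_left_mono) auto
  also have "\<dots> = (real w + 2) * l + 1" by (simp add: field_simps)
  finally have 1: "(real w + 2) * lam \<delta> (Suc w) \<le> (real w + 1) * l + 2 * l"
    using l by (simp add: algebra_simps)
  have 2: "unit_cost \<delta> n (Suc w) \<le> unit_cost \<delta> n w + (real n / (real w + 2) + (2 * l + mu))"
  proof -
    have "real n * lam \<delta> (Suc w) \<le> real n * (l + 1 / (real w + 2))"
      using l' by (intro mult_left_mono) auto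
    then show ?thesis using 1 by (simp add: unit_cost_def l_def algebra_simps)
  qed
  have "real N * ((real w + 2) * lam \<delta> (Suc w)) \<le> real N * ((real w + 1) * l + 2 * l)"
    using 1 by (intro mult_left_mono) auto
  also have "\<dots> = real N * ((real w + 1) * l) + real N * (2 * l)"
    by (simp add: algebra_simps)
  also have "real N * (2 * l) \<le> real n * (2 * l)"
    using assms l by (intro mult_right_mono) auto
  finally have 3: "real N * ((real w + 2) * lam \<delta> (Suc w)) \<le> real N * ((real w + 1) * l) + real n * (2 * l)"
    by simp
  have "real r * unit_cost \<delta> n (Suc w) \<le> real r * (unit_cost \<delta> n w + (real n / (real w + 2) + (2 * l + mu)))"
    using 2 by (intro mult_left_mono) auto
  also have "\<dots> = real r * unit_cost \<delta> n w + (real n * (real r / (real w + 2)) + real r * (2 * l + mu))"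
    by (simp add: algebra_simps)
  also have "real n * (real r / (real w + 2)) \<le> real n * 1"
    using assms by (intro mult_left_mono) auto
  also have "real r * (2 * l + mu) \<le> real w * (2 * l + mu)"
    using assms l mu_nonneg by (intro mult_right_mono) auto
  finally have 4: "real r * unit_cost \<delta> n (Suc w) \<le> real r * unit_cost \<delta> n w + (real n + real w * (2 * l + mu))"
    by simp
  show ?thesis
    unfolding potential_def l_def[symmetric] using 3 4 by (simp add: add.commute[of 2])
qed

text \<open>Lowering N releases 30000 * (w + 1) * \<open>lam \<delta> w\<close>. This pays for the
  expected test and, as p is of order 1 / n, also for p times a needless tournament and a larger
  w.\<close>

lemma potential_covered:
  assumes "N < n" "r \<le> w" "s \<le> w"
    and "0 \<le> p" "p \<le> \<delta> / (8 * real n)"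
  shows "1080 * (real s * lam \<delta> s) + potential \<delta> n N w r
      + p * (32400 * (real n * lam \<delta> s) + potential \<delta> n N (Suc w) r - potential \<delta> n N w r)
    \<le> potential \<delta> n (Suc N) w r"
proof -
  define l where "l = lam \<delta> w"
  have l: "1 \<le> l" using lam_ge[of w] by (simp add: l_def)
  have ls: "lam \<delta> s \<le> l" "0 \<le> lam \<delta> s"
    using lam_mono[OF assms(3)] lam_ge[of s] by (auto simp: l_def)
  have pn: "p * real n \<le> 1/16"
  proof -
    have "p * real n \<le> \<delta> / (8 * real n) * real n"
      using assms by (intro mult_right_mono) auto
    also have "\<dots> = \<delta> / 8" using n by simp
    finally show ?thesis using \<delta> by simp
  qed
  have "real n * 1 \<le> real n * l" using l by (intro mult_left_mono) auto
  moreover have "real w * mu \<le> real w * (2 * real n * l)"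
    using mu_le[of w] by (intro mult_left_mono) (auto simp: l_def)
  moreover have "1 * (real w * l) \<le> real n * (real w * l)"
    using n l by (intro mult_right_mono) auto
  moreover have "real n * lam \<delta> s \<le> real n * l"
    using ls by (intro mult_left_mono) auto
  moreover have "potential \<delta> n N (Suc w) r \<le> potential \<delta> n N w r
    + (60000 * (real n * l) + 40000 * (real n + real w * (2 * l + mu)))"
    unfolding l_def by (rule potential_Suc) (use assms in auto)
  \<comment> \<open>132400 = 32400 + 60000 + 40000; half of 160000 comes from 2 * l and half from
    bounding \<mu>.\<close>
  ultimately have "32400 * (real n * lam \<delta> s) + potential \<delta> n N (Suc w) r - potential \<delta> n N w r
      \<le> real n * (132400 * l + 160000 * (real w * l))"
    by (simp add: algebra_simps)
  then have "p * (32400 * (real n * lam \<delta> s) + potential \<delta> n N (Suc w) r - potential \<delta> n N w r)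
      \<le> p * (real n * (132400 * l + 160000 * (real w * l)))"
    using assms by (intro mult_left_mono) auto
  also have "\<dots> = (p * real n) * (132400 * l + 160000 * (real w * l))"
    by simp
  also have "\<dots> \<le> 1/16 * (132400 * l + 160000 * (real w * l))"
    using pn l by (intro mult_right_mono) auto
  finally have 1: "p * (32400 * (real n * lam \<delta> s) + potential \<delta> n N (Suc w) r - potential \<delta> n N w r)
      \<le> 8275 * l + 10000 * (real w * l)" by simp
  have 2: "real s * lam \<delta> s \<le> real w * l"
    using ls assms by (intro mult_mono) auto
  have 3: "potential \<delta> n (Suc N) w r = potential \<delta> n N w r + 30000 * ((real w + 1) * l)"
    by (simp add: potential_def l_def algebra_simps)
  have "0 \<le> real w * l" using l by simp
  moreover have "30000 * ((real w + 1) * l) = 30000 * (real w * l) + 30000 * l"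
    by (simp add: algebra_simps)
  ultimately show ?thesis using 1 2 3 l by linarith
qed

text \<open>Here e belongs to the tournament and p to the test. Finding a point releases 40000 unit
  costs, against 32400 for the work and (180000 + 40000) / 256 for the errors, so constant failure
  probabilities suffice for the cost.\<close>

lemma potential_uncovered:
  assumes "N < n" "Suc r \<le> w" "s \<le> w" "0 \<le> e" "e \<le> 1/256" "0 \<le> p" "p \<le> 1/256"
  shows "2700 * (real s * (lam \<delta> s + mu)) + 32400 * (real n * lam \<delta> s) + potential \<delta> n N w r
      + e * (potential \<delta> n N (Suc w) (Suc r) - potential \<delta> n N w r) + p * (40000 * unit_cost \<delta> n w)
    \<le> potential \<delta> n (Suc N) w (Suc r)"
proof -
  define l where "l = lam \<delta> w"
  define Q where "Q = unit_cost \<delta> n w"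
  have l: "1 \<le> l" using lam_ge[of w] by (simp add: l_def)
  have ls: "lam \<delta> s \<le> l" "0 \<le> lam \<delta> s"
    using lam_mono[OF assms(3)] lam_ge[of s] by (auto simp: l_def)
  have Q: "Q = real n * l + (real w + 1) * (l + mu)" by (simp add: Q_def unit_cost_def l_def)
  have w0: "0 \<le> real w * l" "0 \<le> real w * mu" "0 \<le> real n * l"
    using l mu_nonneg by auto
  have nl: "real n * 1 \<le> real n * l" using l by (intro mult_left_mono) auto
  have step: "potential \<delta> n N w (Suc r) = potential \<delta> n N w r + 40000 * Q"
    by (simp add: potential_def Q_def algebra_simps)
  have "potential \<delta> n N (Suc w) (Suc r) \<le> potential \<delta> n N w (Suc r)
    + (60000 * (real n * l) + 40000 * (real n + real w * (2 * l + mu)))"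
    unfolding l_def by (rule potential_Suc) (use assms in auto)
  also have "60000 * (real n * l) + 40000 * (real n + real w * (2 * l + mu)) \<le> 140000 * Q"
    using nl w0 l mu_nonneg unfolding Q distrib_left distrib_right by linarith
  finally have "potential \<delta> n N (Suc w) (Suc r) - potential \<delta> n N w r \<le> 180000 * Q"
    using step by simp
  then have "e * (potential \<delta> n N (Suc w) (Suc r) - potential \<delta> n N w r) \<le> e * (180000 * Q)"
    using assms by (intro mult_left_mono) auto
  also have "\<dots> \<le> 1/256 * (180000 * Q)"
    using assms unit_cost_nonneg[of w] by (intro mult_right_mono) (auto simp: Q_def)
  finally have 1: "e * (potential \<delta> n N (Suc w) (Suc r) - potential \<delta> n N w r) \<le> 1/256 * (180000 * Q)" .
  have 2: "p * (40000 * Q) \<le> 1/256 * (40000 * Q)"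
    using assms unit_cost_nonneg[of w] by (intro mult_right_mono) (auto simp: Q_def)
  have 3: "real n * lam \<delta> s \<le> real n * l"
    using ls by (intro mult_left_mono) auto
  have 4: "real s * (lam \<delta> s + mu) \<le> real w * (l + mu)"
    using ls assms mu_nonneg by (intro mult_mono) auto
  have 5: "2700 * (real w * (l + mu)) + 32400 * (real n * l) \<le> 32400 * Q"
    using w0 l mu_nonneg unfolding Q distrib_left distrib_right by linarith
  have 6: "potential \<delta> n N w (Suc r) \<le> potential \<delta> n (Suc N) w (Suc r)"
    using l by (simp add: potential_def l_def[symmetric] mult_right_mono)
  have "0 \<le> Q" using unit_cost_nonneg by (simp add: Q_def)
  then show ?thesis
    using 1 2 3 4 5 6 step unfolding Q_def[symmetric] by linarith
qed

end

end

section \<open>The skyline algorithm\<close>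

context skyline_input
begin

text \<open>S is arbitrary, possibly with wrong or repeated labels, so the induction also covers
  runs after an error.\<close>

lemma cost_find_all:
  assumes \<delta>: "0 < \<delta>" "\<delta> < 1/2" and n: "0 < n" and d: "0 < d"
    and xs: "length xs \<le> n" "set xs \<subseteq> {..<n}"
  shows "upper tr 1 (\<lambda>_. 0) (find_all d n \<delta> xs S)
    \<le> real d * potential \<delta> n (length xs) (length S + card (skyline_labels - set S))
        (card (skyline_labels - set S))"
  using xs
proof (induction xs arbitrary: S)
  case Nil
  then show ?case
    using unit_cost_nonneg[OF \<delta> n] by (simp add: potential_def)
next
  case (Cons x xs)
  define s where "s = length S"
  define m where "m = precision \<delta> s"
  define l where "l = rounds \<delta> n m"
  define r where "r = card (skyline_labels - set S)"
  define w where "w = s + r"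
  define N where "N = length xs"
  define \<mu> where "\<mu> = ln (real n / \<delta>)"
  define Y where "Y = (\<lambda>w r. real d * potential \<delta> n N w r)"
  define F where "F = 32400 * (real n * real d * lam \<delta> s)"
  have N: "N < n" and x: "x < n" using Cons.prems by (auto simp: N_def)
  have m: "m \<ge> 3" using precision_ge_3[OF \<delta>] by (simp add: m_def)
  have m_le: "real m + 3 \<le> 15 * lam \<delta> s" using precision_le[OF \<delta>] by (simp add: m_def)
  let ?test = "uncovered_test d l m x S"
  let ?find = "find_skyline d n m x"
  let ?U = "upper tr 1 (\<lambda>_. 0)"
  let ?found = "bind_prog ?find (\<lambda>q. find_all d n \<delta> xs (q # S))"
  have lam0: "0 \<le> lam \<delta> s" using lam_ge[OF \<delta>, of s] by simp
  have F: "real (depth ?find) \<le> F"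
  proof -
    have "real (depth ?find) \<le> 2160 * real n * real d * (real m + 3)"
      by (rule depth_find_skyline[OF d n])
    also have "\<dots> \<le> 2160 * real n * real d * (15 * lam \<delta> s)"
      using m_le by (intro mult_left_mono) auto
    finally show ?thesis by (simp add: F_def)
  qed
  have F0: "0 \<le> F" using lam0 by (simp add: F_def)
  have IH: "?U (find_all d n \<delta> xs S') \<le> Y (length S' + card (skyline_labels - set S')) (card (skyline_labels - set S'))" for S'
    using Cons.IH[of S'] Cons.prems by (simp add: Y_def N_def)
  have Y_mono: "Y w r \<le> Y w' r'" if "w \<le> w'" "r \<le> r'" for w w' r r'
    unfolding Y_def by (intro mult_left_mono potential_mono[OF \<delta> n] that) simp
  have keep: "?U (find_all d n \<delta> xs S) \<le> Y w r"
    using IH[of S] by (simp add: w_def r_def s_def)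
  have any: "?U (find_all d n \<delta> xs (q # S)) \<le> Y (Suc w) r" for q
  proof -
    have "card (skyline_labels - set (q # S)) \<le> r"
      unfolding r_def by (intro card_mono) (auto simp: finite_skyline_labels)
    then show ?thesis
      by (intro order_trans[OF IH] Y_mono) (auto simp: w_def s_def)
  qed
  have test: "?U (find_all d n \<delta> (x # xs) S)
      \<le> ?U ?test + upper tr 0 (\<lambda>b. ?U (if b then ?found else find_all d n \<delta> xs S)) ?test"
    using upper_cost_le[of tr "\<lambda>b. ?U (if b then ?found else find_all d n \<delta> xs S)" ?test]
    by (simp add: Let_def upper_bind s_def[symmetric] m_def[symmetric] l_def[symmetric])
  have found: "?U ?found \<le> F + upper tr 0 (\<lambda>q. ?U (find_all d n \<delta> xs (q # S))) ?find"
    using upper_cost_le_depth[of tr "\<lambda>q. ?U (find_all d n \<delta> xs (q # S))" ?find] F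
    by (simp add: upper_bind)
  have "?U (find_all d n \<delta> (x # xs) S) \<le> real d * potential \<delta> n (Suc N) w r"
  proof (cases "covered x S")
    case True
    obtain j where j: "l = Suc j" by (auto simp: l_def rounds_def)
    define p where "p = \<delta> / (8 * real n)"
    have "upper tr 0 (\<lambda>q. ?U (find_all d n \<delta> xs (q # S))) ?find \<le> Y (Suc w) r"
      using upper_mono[of "\<lambda>q. ?U (find_all d n \<delta> xs (q # S))" "\<lambda>_. Y (Suc w) r" tr 0 ?find] any
      by simp
    then have found': "?U ?found \<le> F + Y (Suc w) r" using found by linarith
    have "upper tr 0 (\<lambda>b. ?U (if b then ?found else find_all d n \<delta> xs S)) ?test
        \<le> Y w r + p * ((F + Y (Suc w) r) - Y w r)"
    proof (rule upper_le_good_bad[where P = "\<lambda>b. \<not> b"])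
      show "Y w r \<le> F + Y (Suc w) r" using F0 Y_mono[of w "Suc w" r r] by simp
      then show "?U (if b then ?found else find_all d n \<delta> xs S) \<le> F + Y (Suc w) r" for b
        using found' keep by auto
      show "err tr (\<lambda>b. \<not> b) ?test \<le> p"
        using err_uncovered_test_no[OF True, of j m] half_power_rounds[OF \<delta> n, of m j] j m
        by (simp add: p_def l_def[symmetric])
    qed (use keep in auto)
    moreover have "?U ?test \<le> real d * (1080 * (real s * lam \<delta> s))"
    proof -
      have "?U ?test \<le> 72 * real d * (real m + 3) * real s"
        unfolding s_def by (rule cost_uncovered_test[OF True m d])
      also have "\<dots> \<le> 72 * real d * (15 * lam \<delta> s) * real s"
        using m_le by (intro mult_left_mono mult_right_mono) auto
      finally show ?thesis by (simp add: mult_ac)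
    qed
    ultimately have "?U (find_all d n \<delta> (x # xs) S) \<le> real d * (1080 * (real s * lam \<delta> s))
        + (Y w r + p * ((F + Y (Suc w) r) - Y w r))"
      using test by linarith
    also have "\<dots> = real d * (1080 * (real s * lam \<delta> s) + potential \<delta> n N w r
      + p * (32400 * (real n * lam \<delta> s) + potential \<delta> n N (Suc w) r - potential \<delta> n N w r))"
      by (simp add: Y_def F_def algebra_simps)
    also have "\<dots> \<le> real d * potential \<delta> n (Suc N) w r"
      by (intro mult_left_mono potential_covered[OF \<delta> n N]) (use \<delta> in \<open>auto simp: p_def w_def\<close>)
    finally show ?thesis .
  next
    case False
    obtain t where t: "is_top x t" using ex_top[OF x] by blast
    have t': "t \<in> skyline_labels" "t \<notin> set S"
      using top_in_skyline[OF x t] t False by (auto simp: covered_def is_top_def)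
    have tr: "card (skyline_labels - set (t # S)) = r - 1" "r \<noteq> 0"
    proof -
      have "skyline_labels - set (t # S) = (skyline_labels - set S) - {t}" by auto
      then show "card (skyline_labels - set (t # S)) = r - 1"
        using t' by (simp add: r_def card_Diff_singleton)
      show "r \<noteq> 0"
        using t' finite_skyline_labels by (auto simp: r_def)
    qed
    then obtain r' where r': "r = Suc r'" by (cases r) auto
    define e where "e = level_error \<delta> s"
    define G where "G = F + (Y w r' + e * (Y (Suc w) r - Y w r'))"
    define Q where "Q = unit_cost \<delta> n w"
    have Q0: "0 \<le> Q" using unit_cost_nonneg[OF \<delta> n] by (simp add: Q_def)
    have e: "0 \<le> e" "e \<le> 1/256"
      using level_error_pos[OF \<delta>, of s] level_error_le[OF \<delta>, of s] by (auto simp: e_def)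
    have Y_le: "Y w r' \<le> Y (Suc w) r" by (rule Y_mono) (auto simp: r')
    have "upper tr 0 (\<lambda>q. ?U (find_all d n \<delta> xs (q # S))) ?find \<le> Y w r' + e * (Y (Suc w) r - Y w r')"
    proof (rule upper_le_good_bad[where P = "\<lambda>q. q = t"])
      show "?U (find_all d n \<delta> xs (q # S)) \<le> Y w r'" if "q = t" for q
        using IH[of "t # S"] tr that by (simp add: r' w_def s_def)
      show "err tr (\<lambda>q. q = t) ?find \<le> e"
        unfolding e_def m_def
        by (rule order_trans[OF err_find_skyline[OF t] half_power_precision_le[OF \<delta>]])
    qed (use any Y_le in auto)
    then have found': "?U ?found \<le> G" using found by (simp add: G_def)
    \<comment> \<open>A wrong dismissal saves the tournament but leaves one more point to find,
      worth 40000 unit costs.\<close>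
    have Y_step: "Y w r = Y w r' + real d * (40000 * Q)"
      by (simp add: Y_def potential_def Q_def r' algebra_simps)
    have Y_le_G: "Y w r' \<le> G"
      using F0 e Y_le by (simp add: G_def)
    have "upper tr 0 (\<lambda>b. ?U (if b then ?found else find_all d n \<delta> xs S)) ?test
        \<le> G + e * ((G + real d * (40000 * Q)) - G)"
    proof (rule upper_le_good_bad[where P = "\<lambda>b. b"])
      show "G \<le> G + real d * (40000 * Q)" using Q0 by simp
      then have "?U ?found \<le> G + real d * (40000 * Q)" "?U (find_all d n \<delta> xs S) \<le> G + real d * (40000 * Q)"
        using found' keep Y_step Y_le_G by linarith+
      then show "?U (if b then ?found else find_all d n \<delta> xs S) \<le> G + real d * (40000 * Q)" for b
        by simp
      have "err tr (\<lambda>b. b) ?test \<le> 4 * real s * (1/2) ^ m"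
        unfolding s_def by (rule err_uncovered_test_yes[OF False]) (use m in simp)
      also have "\<dots> \<le> e"
        unfolding e_def m_def by (rule half_power_precision_mult_le[OF \<delta>])
      finally show "err tr (\<lambda>b. b) ?test \<le> e" .
    qed (use found' in auto)
    moreover have "?U ?test \<le> real d * (2700 * (real s * (lam \<delta> s + \<mu>)))"
    proof -
      have "?U ?test \<le> real (depth ?test)" by (rule upper_le_depth)
      also have "\<dots> \<le> 36 * real d * (real m + 3) * real s * (2 ^ l - 1)"
        unfolding s_def by (rule depth_uncovered_test[OF d])
      also have "\<dots> \<le> 36 * real d * (real m + 3) * real s * 2 ^ l"
        by (intro mult_left_mono) auto
      also have "\<dots> = 36 * real d * real s * ((real m + 3) * 2 ^ l)"
        by simp
      also have "\<dots> \<le> 36 * real d * real s * (75 * (lam \<delta> s + \<mu>))"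
        unfolding l_def \<mu>_def by (intro mult_left_mono rounds_le[OF \<delta> n m_def]) auto
      finally show ?thesis by (simp add: mult_ac)
    qed
    ultimately have "?U (find_all d n \<delta> (x # xs) S) \<le> real d * (2700 * (real s * (lam \<delta> s + \<mu>)))
        + (G + e * (real d * (40000 * Q)))"
      using test by simp
    also have "\<dots> = real d * (2700 * (real s * (lam \<delta> s + \<mu>)) + 32400 * (real n * lam \<delta> s)
      + potential \<delta> n N w r' + e * (potential \<delta> n N (Suc w) (Suc r') - potential \<delta> n N w r')
      + e * (40000 * unit_cost \<delta> n w))"
      by (simp add: Y_def F_def G_def Q_def r' algebra_simps)
    also have "\<dots> \<le> real d * potential \<delta> n (Suc N) w r"
      unfolding \<mu>_def r'
      by (intro mult_left_mono potential_uncovered[OF \<delta> n N]) (use e in \<open>auto simp: w_def r'\<close>)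
    finally show ?thesis .
  qed
  then show ?case by (simp add: N_def w_def r_def s_def)
qed

text \<open>The first summand is the error budget left for all levels from \<open>length S\<close>
  on; the second allows each remaining label to be retained wrongly.\<close>

lemma err_find_all:
  assumes \<delta>: "0 < \<delta>" "\<delta> < 1/2" and n: "0 < n"
    and "set xs \<subseteq> {..<n}" "set S \<subseteq> skyline_labels" "skyline_labels \<subseteq> set S \<union> set xs"
  shows "err tr (\<lambda>R. R = skyline_labels) (find_all d n \<delta> xs S)
    \<le> \<delta> / (2 * (real (length S) + 1)) + real (length xs) * (\<delta> / (8 * real n))"
  using assms(4-6)
proof (induction xs arbitrary: S)
  case Nil
  then have "set S \<inter> {..<n} = skyline_labels" by (auto simp: skyline_labels_def)
  then show ?case using \<delta> by simp
next
  case (Cons x xs)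
  define s where "s = length S"
  define m where "m = precision \<delta> s"
  define l where "l = rounds \<delta> n m"
  define e where "e = level_error \<delta> s"
  define p where "p = \<delta> / (8 * real n)"
  define W where "W = (\<lambda>s. \<delta> / (2 * (real s + 1)) + real (length xs) * p)"
  let ?test = "uncovered_test d l m x S"
  let ?find = "find_skyline d n m x"
  let ?found = "bind_prog ?find (\<lambda>q. find_all d n \<delta> xs (q # S))"
  let ?err = "err tr (\<lambda>R. R = skyline_labels)"
  have x: "x < n" using Cons.prems by simp
  have p0: "0 \<le> p" using \<delta> by (simp add: p_def)
  have e0: "0 \<le> e" using level_error_pos[OF \<delta>, of s] by (simp add: e_def)
  have W0: "0 \<le> W s" for s using \<delta> p0 by (simp add: W_def)
  have m: "m \<ge> 3" using precision_ge_3[OF \<delta>] by (simp add: m_def)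
  have W_step: "W (Suc s) + 2 * e \<le> W s"
  proof -
    \<comment> \<open>The difference of 1 / (s + 1) and 1 / (s + 2) is their product, so level s
      releases 32 * e. Only 2 * e is spent, on the test of a skyline point and on the
      tournament.\<close>
    have "\<delta> / (2 * (real s + 1)) = \<delta> / (2 * (real s + 2)) + 32 * e"
      by (simp add: e_def level_error_def divide_simps) (simp add: algebra_simps)
    then show ?thesis using e0 by (simp add: W_def add.commute)
  qed
  have step: "find_all d n \<delta> (x # xs) S = bind_prog ?test (\<lambda>b. if b then ?found else find_all d n \<delta> xs S)"
    by (simp add: Let_def s_def[symmetric] m_def[symmetric] l_def[symmetric])
  have keep: "?err (find_all d n \<delta> xs S) \<le> W s" if "x \<in> skyline_labels \<Longrightarrow> x \<in> set S"
    using Cons.IH[of S] Cons.prems that by (auto simp: W_def s_def p_def)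
  have "?err (find_all d n \<delta> (x # xs) S) \<le> W s + p"
  proof (cases "covered x S")
    case True
    obtain j where j: "l = Suc j" by (auto simp: l_def rounds_def)
    have "?err (find_all d n \<delta> (x # xs) S) \<le> p + W s"
      unfolding step
    proof (rule err_bind_le[where P = "\<lambda>b. \<not> b"])
      show "err tr (\<lambda>b. \<not> b) ?test \<le> p"
        using err_uncovered_test_no[OF True, of j m] half_power_rounds[OF \<delta> n, of m j] j m
        by (simp add: p_def l_def[symmetric])
      obtain q where q: "q \<in> set S" "label_le x q" using True by (auto simp: covered_def)
      then have "q < n" using Cons.prems by (auto simp: skyline_labels_def)
      then have "x \<in> skyline_labels \<Longrightarrow> x \<in> set S"
        using skyline_label_le_eq q by blast
      then show "?err (if b then ?found else find_all d n \<delta> xs S) \<le> W s" if "\<not> b" for b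
        using keep that by simp
    qed (rule W0)
    then show ?thesis by simp
  next
    case False
    obtain t where t: "is_top x t" using ex_top[OF x] by blast
    have t': "t \<in> skyline_labels" by (rule top_in_skyline[OF x t])
    have xt: "x \<in> skyline_labels \<Longrightarrow> x = t"
      using skyline_label_le_eq t by (auto simp: is_top_def)
    have found: "?err ?found \<le> e + W (Suc s)"
    proof (rule err_bind_le[where P = "\<lambda>q. q = t"])
      show "err tr (\<lambda>q. q = t) ?find \<le> e"
        unfolding e_def m_def
        by (rule order_trans[OF err_find_skyline[OF t] half_power_precision_le[OF \<delta>]])
      have "?err (find_all d n \<delta> xs (t # S)) \<le> W (Suc s)"
        using Cons.IH[of "t # S"] Cons.prems t' xt by (auto simp: W_def s_def p_def)
      then show "?err (find_all d n \<delta> xs (q # S)) \<le> W (Suc s)" if "q = t" for q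
        using that by simp
    qed (rule W0)
    have "?err (find_all d n \<delta> (x # xs) S) \<le> W s"
    proof (cases "x \<in> skyline_labels")
      case True
      have "?err (find_all d n \<delta> (x # xs) S) \<le> e + (e + W (Suc s))"
        unfolding step
      proof (rule err_bind_le[where P = "\<lambda>b. b"])
        have "err tr (\<lambda>b. b) ?test \<le> 4 * real s * (1/2) ^ m"
          unfolding s_def by (rule err_uncovered_test_yes[OF False]) (use m in simp)
        also have "\<dots> \<le> e"
          unfolding e_def m_def by (rule half_power_precision_mult_le[OF \<delta>])
        finally show "err tr (\<lambda>b. b) ?test \<le> e" .
      qed (use found e0 W0 in auto)
      then show ?thesis using W_step by simp
    next
      case notin: False
      \<comment> \<open>Dismissing x loses nothing and retaining it finds t, so the test is not
        charged, however many such x occur at the same level.\<close>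
      have "?err (find_all d n \<delta> (x # xs) S) \<le> 0 + W s"
        unfolding step
        by (rule err_bind_le[where P = "\<lambda>_. True"]) (use found keep notin W_step e0 W0 in auto)
      then show ?thesis by simp
    qed
    then show ?thesis using p0 by simp
  qed
  then show ?case by (simp add: W_def s_def p_def distrib_right add_divide_distrib)
qed

end

section \<open>From the potential to the final bounds\<close>

lemma potential_le:
  assumes \<delta>: "0 < \<delta>" "\<delta> < 1/2" and n: "0 < n" and k: "0 < k"
  shows "potential \<delta> n n k k
    \<le> 600000 * (real n * real k * ln (real k / \<delta>) + (real k)\<^sup>2 * ln (real k * real n / \<delta>))"
proof -
  define L where "L = ln (real k / \<delta>)"
  define M where "M = ln (real k * real n / \<delta>)"
  have k1: "1 \<le> real k" and n1: "1 \<le> real n" using k n by auto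
  have kd: "2 \<le> real k / \<delta>"
  proof -
    have "2 * \<delta> \<le> real k" using \<delta> k1 by linarith
    then show ?thesis using \<delta> by (simp add: pos_le_divide_eq)
  qed
  have L2: "ln 2 \<le> L" unfolding L_def using kd by simp
  have lam: "lam \<delta> k \<le> 3 * L"
  proof -
    \<comment> \<open>k + 2 \<le> 4 * k, and ln 4 = 2 * ln 2 is at most 2 * L.\<close>
    have "lam \<delta> k \<le> ln (4 * (real k / \<delta>))"
      unfolding lam_def using \<delta> k1 by (simp add: divide_right_mono)
    also have "\<dots> = ln 4 + L"
      unfolding L_def using kd by (intro ln_mult_pos) auto
    also have "ln (4::real) = 2 * ln 2"
      using ln_realpow[of 2 2] by simp
    finally show ?thesis using L2 by linarith
  qed
  have kn: "real k \<le> real k * real n" "real n \<le> real k * real n"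
    using k1 n1 by (simp_all add: mult_le_cancel_left1 mult_le_cancel_right1)
  have LM: "L \<le> M" and muM: "ln (real n / \<delta>) \<le> M"
    unfolding L_def M_def using kn \<delta> k1 n1 by (auto intro!: divide_right_mono)
  have L0: "0 \<le> L" using L2 ln_2_less_1 ln_gt_zero[of 2] by linarith
  have "(real k + 1) * lam \<delta> k \<le> (2 * real k) * (3 * L)"
    using k1 lam lam_ge[OF \<delta>, of k] by (intro mult_mono) auto
  then have 1: "real n * ((real k + 1) * lam \<delta> k) \<le> real n * ((2 * real k) * (3 * L))"
    by (intro mult_left_mono) auto
  have "(real k + 1) * (lam \<delta> k + ln (real n / \<delta>)) \<le> (2 * real k) * (4 * M)"
    using k1 lam lam_ge[OF \<delta>, of k] mu_nonneg[OF \<delta> n] muM LM by (intro mult_mono) auto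
  moreover have "real n * lam \<delta> k \<le> real n * (3 * L)"
    using lam by (intro mult_left_mono) auto
  ultimately have "unit_cost \<delta> n k \<le> real n * (3 * L) + (2 * real k) * (4 * M)"
    unfolding unit_cost_def by linarith
  then have 2: "real k * unit_cost \<delta> n k \<le> real k * (real n * (3 * L) + (2 * real k) * (4 * M))"
    by (intro mult_left_mono) auto
  have "potential \<delta> n n k k \<le> 30000 * (real n * ((2 * real k) * (3 * L)))
      + 40000 * (real k * (real n * (3 * L) + (2 * real k) * (4 * M)))"
    unfolding potential_def using 1 2 by linarith
  also have "\<dots> = 300000 * (real n * real k * L) + 320000 * ((real k)\<^sup>2 * M)"
    by (simp add: algebra_simps power2_eq_square)
  also have "\<dots> \<le> 600000 * (real n * real k * L + (real k)\<^sup>2 * M)"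
    using L0 LM by simp
  finally show ?thesis by (simp add: L_def M_def)
qed

text \<open>In the degenerate cases the cost bound is 0, so no query may be asked; nothing is
  strictly dominated and all labels are returned.\<close>

definition skyline_alg :: "real \<Rightarrow> nat \<Rightarrow> nat \<Rightarrow> nat set prog" where
  "skyline_alg \<delta> n d = (if d = 0 \<or> n = 0 then Ret {..<n} else find_all d n \<delta> [0..<n] [])"

context skyline_input
begin

lemma skyline_labels_trivial:
  assumes "d = 0 \<or> n = 0"
  shows "skyline_labels = {..<n}"
  using assms bij_pt
  by (auto simp: skyline_labels_def skyline_def strictly_dominated_def bij_betw_def)

lemma set_skyline_alg: "R \<in> set_prog (skyline_alg \<delta> n d) \<Longrightarrow> R \<subseteq> {..<n}"
  by (auto simp: skyline_alg_def split: if_splits dest: set_find_all)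

lemma err_skyline_alg:
  assumes "0 < \<delta>" "\<delta> < 1/2"
  shows "err tr (\<lambda>R. R = skyline_labels) (skyline_alg \<delta> n d) \<le> \<delta>"
proof (cases "d = 0 \<or> n = 0")
  case True
  then show ?thesis using assms by (simp add: skyline_alg_def skyline_labels_trivial)
next
  case False
  have "err tr (\<lambda>R. R = skyline_labels) (find_all d n \<delta> [0..<n] [])
      \<le> \<delta> / (2 * (real (length ([] :: nat list)) + 1)) + real (length [0..<n]) * (\<delta> / (8 * real n))"
    by (rule err_find_all[OF assms]) (use False in \<open>auto simp: skyline_labels_def\<close>)
  then show ?thesis using False assms by (simp add: skyline_alg_def)
qed

lemma cost_skyline_alg:
  assumes "0 < \<delta>" "\<delta> < 1/2"
  defines "k \<equiv> card skyline_labels"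
  shows "upper tr 1 (\<lambda>_. 0) (skyline_alg \<delta> n d)
    \<le> 600000 * (real n * real d * real k * ln (real k / \<delta>)
        + real d * (real k)\<^sup>2 * ln (real k * real n / \<delta>))"
proof (cases "d = 0 \<or> n = 0")
  case True
  have "d = 0 \<or> k = 0"
    using True by (auto simp: k_def skyline_labels_trivial)
  then show ?thesis using True by (auto simp: skyline_alg_def)
next
  case False
  then have n: "0 < n" and d: "0 < d" by auto
  have k: "0 < k"
    using ex_top[OF n] top_in_skyline[OF n] finite_skyline_labels by (auto simp: k_def card_gt_0_iff)
  have "upper tr 1 (\<lambda>_. 0) (skyline_alg \<delta> n d) \<le> real d * potential \<delta> n n k k"
    using cost_find_all[OF assms(1,2) n d, of "[0..<n]" "[]"] False
    by (simp add: skyline_alg_def k_def lessThan_atLeast0)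
  also have "\<dots> \<le> real d * (600000 * (real n * real k * ln (real k / \<delta>)
      + (real k)\<^sup>2 * ln (real k * real n / \<delta>)))"
    by (intro mult_left_mono potential_le[OF assms(1,2) n k]) simp
  finally show ?thesis by (simp add: algebra_simps)
qed

lemma run_skyline_alg:
  assumes \<delta>: "0 < \<delta>" "\<delta> < 1/2" and acc: "noise_model acc"
  defines "k \<equiv> card (skyline d X)"
    and "D \<equiv> run tr acc 0 (alg_of (skyline_alg \<delta> n d))"
  shows "lossless_spmf D" "\<forall>(S, c) \<in> set_spmf D. S \<subseteq> {..<n}"
    "measure (measure_spmf D) {(S, c). pt ` S = skyline d X} \<ge> 1 - \<delta>"
    "(\<integral>\<^sup>+ (S, c). ennreal (real c) \<partial>measure_spmf D)
      \<le> ennreal (600000 * (real n * real d * real k * ln (real k / \<delta>)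
                        + real d * (real k)\<^sup>2 * ln (real k * real n / \<delta>)))"
proof -
  show lossless: "lossless_spmf D"
    unfolding D_def by (rule lossless_run_alg_of)
  show "\<forall>(S, c) \<in> set_spmf D. S \<subseteq> {..<n}"
    unfolding D_def by (auto dest!: set_run_alg_of set_skyline_alg)
  let ?B = "{(S, c :: nat). S \<noteq> skyline_labels}"
  have "emeasure (measure_spmf D) ?B
      = (\<integral>\<^sup>+ (S, c). ennreal (of_bool (S \<noteq> skyline_labels) + 0 * real c) \<partial>measure_spmf D)"
    by (simp flip: nn_integral_indicator add: indicator_def case_prod_unfold of_bool_def if_distrib[of ennreal] cong: if_cong)
  also have "\<dots> \<le> ennreal (err tr (\<lambda>R. R = skyline_labels) (skyline_alg \<delta> n d) + 0 * real 0)"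
    unfolding D_def by (rule upper_sound[OF acc]) auto
  also have "\<dots> \<le> ennreal \<delta>"
    using err_skyline_alg[OF \<delta>] by (intro ennreal_leI) simp
  finally have B: "measure (measure_spmf D) ?B \<le> \<delta>"
    using \<delta> by (simp add: measure_spmf.emeasure_eq_measure)
  have "1 = measure (measure_spmf D) (space (measure_spmf D))"
    using lossless by (simp add: lossless_spmf_def weight_spmf_def)
  also have "\<dots> \<le> measure (measure_spmf D) ({(S, c). pt ` S = skyline d X} \<union> ?B)"
    using image_skyline_labels by (intro measure_spmf.finite_measure_mono) auto
  also have "\<dots> \<le> measure (measure_spmf D) {(S, c). pt ` S = skyline d X} + measure (measure_spmf D) ?B"
    by (rule measure_Un_le) auto
  finally show "measure (measure_spmf D) {(S, c). pt ` S = skyline d X} \<ge> 1 - \<delta>"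
    using B by linarith
  have "(\<integral>\<^sup>+ (S, c). ennreal (real c) \<partial>measure_spmf D)
      = (\<integral>\<^sup>+ (S, c). ennreal (0 + 1 * real c) \<partial>measure_spmf D)"
    by simp
  also have "\<dots> \<le> ennreal (upper tr 1 (\<lambda>_. 0) (skyline_alg \<delta> n d) + 1 * real 0)"
    unfolding D_def by (rule upper_sound[OF acc]) auto
  also have "\<dots> \<le> ennreal (600000 * (real n * real d * real k * ln (real k / \<delta>)
                        + real d * (real k)\<^sup>2 * ln (real k * real n / \<delta>)))"
    using cost_skyline_alg[OF \<delta>] by (intro ennreal_leI) (simp add: k_def card_skyline_labels)
  finally show "(\<integral>\<^sup>+ (S, c). ennreal (real c) \<partial>measure_spmf D)
      \<le> ennreal (600000 * (real n * real d * real k * ln (real k / \<delta>)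
                        + real d * (real k)\<^sup>2 * ln (real k * real n / \<delta>)))" .
qed

end

theorem theorem2:
  "\<exists>(alg :: real \<Rightarrow> nat \<Rightarrow> nat \<Rightarrow> nat set query_alg) (C :: real). C > 0 \<and>
    (\<forall>(\<delta> :: real) (n :: nat) (d :: nat) (X :: point set) (pt :: nat \<Rightarrow> point) acc (k :: nat).
      0 < \<delta> \<and> \<delta> < 1/2 \<and> X \<subseteq> euclid d \<and> bij_betw pt {..<n} X \<and> noise_model acc \<and>
      k = card (skyline d X) \<longrightarrow>
      (let D = run (truth n d pt) acc 0 (alg \<delta> n d) in
        lossless_spmf D \<and>
        (\<forall>(S, c) \<in> set_spmf D. S \<subseteq> {..<n}) \<and>
        measure (measure_spmf D) {(S, c). pt ` S = skyline d X} \<ge> 1 - \<delta> \<and>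
        (\<integral>\<^sup>+ (S, c). ennreal (real c) \<partial>measure_spmf D)
          \<le> ennreal (C * (real n * real d * real k * ln (real k / \<delta>)
                        + real d * (real k)\<^sup>2 * ln (real k * real n / \<delta>)))))"
proof (intro exI[of _ "\<lambda>\<delta> n d. alg_of (skyline_alg \<delta> n d)"] exI[of _ "600000 :: real"] conjI allI impI)
  fix \<delta> :: real and n d :: nat and X pt acc and k :: nat
  assume asm: "0 < \<delta> \<and> \<delta> < 1/2 \<and> X \<subseteq> euclid d \<and> bij_betw pt {..<n} X \<and> noise_model acc \<and>
      k = card (skyline d X)"
  interpret skyline_input d n X pt
    by unfold_locales (use asm in auto)
  show "let D = run (truth n d pt) acc 0 (alg_of (skyline_alg \<delta> n d)) in
        lossless_spmf D \<and>
        (\<forall>(S, c) \<in> set_spmf D. S \<subseteq> {..<n}) \<and>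
        measure (measure_spmf D) {(S, c). pt ` S = skyline d X} \<ge> 1 - \<delta> \<and>
        (\<integral>\<^sup>+ (S, c). ennreal (real c) \<partial>measure_spmf D)
          \<le> ennreal (600000 * (real n * real d * real k * ln (real k / \<delta>)
                        + real d * (real k)\<^sup>2 * ln (real k * real n / \<delta>)))"
    unfolding Let_def using run_skyline_alg[of \<delta> acc] asm by auto
qed simp

end
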